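(* Let $H$ be a finite connected simple bipartite graph of maximum degree at most $3$, minimum degree $2$, and girth at least $6$. If $H$ has no adjacency eigenvalue in $(-1,1)$, then $H$ is isomorphic to one of $\Gamma_a,\Gamma_b,\Gamma_c,\Gamma_d$.
   Context: $\Gamma_a$ is the $6$-cycle. $\Gamma_b$ consists of two vertices joined by three internally vertex-disjoint paths of length $3$. For a family $\mathcal{B}$ of subsets of a finite set $P$, its incidence graph is the bipartite graph with parts $P$ and $\mathcal{B}$ where $p\sim B$ iff $p\in B$. $\Gamma_c$ is the incidence graph of $\{a,b,c\},\{a,d,g\},\{a,e,f\},\{b,e\},\{b,f\},\{c,d\},\{c,g\}$ on $\{a,\dots,g\}$. $\Gamma_d$ is the incidence graph of $\{a,b,f\},\{a,c,e\},\{d,e,f\},\{b,c,g\},\{c,d,h\},\{b,d,i\},\{a,g\},\{e,h\},\{f,i\}$ on $\{a,\dots,i\}$. *)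

theory Defs
  imports "Graph_Theory.Graph_Theory" "Jordan_Normal_Form.Char_Poly"
begin

text \<open>
  A finite simple graph is a \<open>pair_graph\<close>: a finite, symmetric, loop-free set of ordered pairs.
  Every undirected edge is represented by its two orientations, so the degree of a vertex is its
  out-degree.
\<close>

definition min_degree :: "('a,'b) pre_digraph \<Rightarrow> nat" where
  "min_degree G = Min (out_degree G ` verts G)"

definition max_degree :: "('a,'b) pre_digraph \<Rightarrow> nat" where
  "max_degree G = Max (out_degree G ` verts G)"

definition bipartite :: "('a,'b) pre_digraph \<Rightarrow> bool" where
  "bipartite G \<longleftrightarrow> (\<exists>U V. verts G = U \<union> V \<and> U \<inter> V = {} \<and> arcs_ends G \<subseteq> U \<times> V \<union> V \<times> U)"

text \<open>
  The library's \<open>cycle\<close> also covers the closed walk \<open>u, v, u\<close> along one undirected edge; the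
  condition on the length excludes it. The girth of a forest is infinite.
\<close>

definition girth :: "('a,'b) pre_digraph \<Rightarrow> enat" where
  "girth G = (INF p \<in> {p. pre_digraph.cycle G p \<and> 3 \<le> length p}. enat (length p))"

definition adj_mat :: "('a,'b) pre_digraph \<Rightarrow> 'a list \<Rightarrow> real mat" where
  "adj_mat G vs = mat (length vs) (length vs)
     (\<lambda>(i,j). if (vs ! i, vs ! j) \<in> arcs_ends G then 1 else 0)"

text \<open>
  Matrices are indexed by initial segments of the naturals, so the vertices have to be listed in
  some order. Reordering them conjugates the matrix by a permutation matrix, so the choice of the
  order is immaterial. All eigenvalues of a real symmetric matrix are real.
\<close>

definition adj_eigenvalue :: "('a,'b) pre_digraph \<Rightarrow> real \<Rightarrow> bool" where
  "adj_eigenvalue G x \<longleftrightarrow>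
     (\<exists>vs. distinct vs \<and> set vs = verts G \<and> eigenvalue (adj_mat G vs) x)"

definition graph_of_edges :: "'a set \<Rightarrow> ('a \<times> 'a) set \<Rightarrow> 'a pair_pre_digraph" where
  "graph_of_edges V E = \<lparr> pverts = V, parcs = E \<union> E\<inverse> \<rparr>"

definition incidence_graph :: "'a set \<Rightarrow> 'a set set \<Rightarrow> ('a + 'a set) pair_pre_digraph" where
  "incidence_graph P \<B> =
     graph_of_edges (Inl ` P \<union> Inr ` \<B>) {(Inl p, Inr B) | p B. p \<in> P \<and> B \<in> \<B> \<and> p \<in> B}"

definition Gamma_a :: "nat pair_pre_digraph" where
  "Gamma_a = graph_of_edges {0..<6} {(0,1), (1,2), (2,3), (3,4), (4,5), (5,0)}"

text \<open>The two end vertices of the three paths are 0 and 1.\<close>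

definition Gamma_b :: "nat pair_pre_digraph" where
  "Gamma_b = graph_of_edges {0..<8}
     {(0,2), (2,3), (3,1),
      (0,4), (4,5), (5,1),
      (0,6), (6,7), (7,1)}"

datatype point = pt_a | pt_b | pt_c | pt_d | pt_e | pt_f | pt_g | pt_h | pt_i

definition Gamma_c :: "(point + point set) pair_pre_digraph" where
  "Gamma_c = incidence_graph {pt_a, pt_b, pt_c, pt_d, pt_e, pt_f, pt_g}
     {{pt_a, pt_b, pt_c}, {pt_a, pt_d, pt_g}, {pt_a, pt_e, pt_f}, {pt_b, pt_e}, {pt_b, pt_f}, {pt_c, pt_d}, {pt_c, pt_g}}"

definition Gamma_d :: "(point + point set) pair_pre_digraph" where
  "Gamma_d = incidence_graph {pt_a, pt_b, pt_c, pt_d, pt_e, pt_f, pt_g, pt_h, pt_i}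
     {{pt_a, pt_b, pt_f}, {pt_a, pt_c, pt_e}, {pt_d, pt_e, pt_f}, {pt_b, pt_c, pt_g}, {pt_c, pt_d, pt_h}, {pt_b, pt_d, pt_i},
      {pt_a, pt_g}, {pt_e, pt_h}, {pt_f, pt_i}}"

end

theory Submission
  imports Defs "HOL-Analysis.Function_Topology"
begin

text \<open>
  Write N(v) for the set of neighbours of v. Since the spectrum of the adjacency matrix A avoids
  (-1,1), the matrix A^2 - I is positive semidefinite. Its entries are deg(v) - 1 on the diagonal and,
  as the girth is at least 6, 0 or 1 elsewhere, so the vertices are represented by vectors of squared
  norm 1 or 2 with inner products 0 or 1. Vectors of squared norm 0 are orthogonal to everything; this
  yields three linear relations: two vertices of degree 2 with a common neighbour have the same vector; if
  p has degree 2, neighbours of its two neighbours always have a common neighbour; and for p of degree 2,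
  q, s of degree 3, pairwise with a common neighbour, a vertex t having a common neighbour with q and s
  but not with p is represented by q + s - 2p. Starting from a vertex of degree 2, these relations
  determine the whole graph. Below, p, q, s, t, u, w are vertices on one side of the bipartition and
  b, c, d, e, f on the other.
\<close>

section \<open>The quadratic form of the squared adjacency matrix\<close>

text \<open>The coefficients come from orthogonal projection. For \<open>p\<close> of degree 2 and
  \<open>q\<close> of degree 3 sharing a neighbour with it, q - p is a unit vector orthogonal to
  \<open>p\<close>. For distinct such \<open>q\<close>, \<open>s\<close> the vectors q - p and s - p
  have inner product -1 or 0, according to whether \<open>q\<close> and \<open>s\<close> have no
  common neighbour or one. If -1, they are opposite, so q + s = 2p, and a 4-cycle results. If 0,
  they are orthonormal; \<open>t\<close> is orthogonal to \<open>p\<close>, has inner product 1 with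
  both, and squared norm at most 2, so it equals their sum. These equalities hold modulo the radical
  of the form, so they yield inner products, that is, which vertices have a common neighbour. One
  function \<open>N\<close> serves both sides of the bipartition, so every statement holds with
  points (\<open>p\<close>, \<open>q\<close>, ...) and blocks (\<open>b\<close>, \<open>c\<close>,
  ...) exchanged. The main obstacle, a vertex of degree 2 between two of degree 3, is ruled out by
  using the relations on both sides. Below, short and long mean degree 2 and degree 3.\<close>

locale neighbourhoods =
  fixes V :: "'a set" and N :: "'a \<Rightarrow> 'a set"
  assumes finite_V: "finite V"
    and N_subset: "N v \<subseteq> V"
    and N_sym: "u \<in> N v \<Longrightarrow> v \<in> N u"
begin

lemma finite_N [simp]: "finite (N v)"
  using finite_subset[OF N_subset finite_V] .

lemma N_iff: "u \<in> N v \<longleftrightarrow> v \<in> N u"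
  using N_sym by blast

lemma N_V: "u \<in> N v \<Longrightarrow> u \<in> V" "u \<in> N v \<Longrightarrow> v \<in> V"
  using N_subset N_sym by blast+

definition adj :: "('a \<Rightarrow> real) \<Rightarrow> 'a \<Rightarrow> real" where
  "adj x v = (\<Sum>u\<in>N v. x u)"

text \<open>The bilinear form of A^2 - m, with A the operator \<open>adj\<close>. Expressing A^2
  through <Ax, Ay> makes symmetry immediate.\<close>

definition form :: "real \<Rightarrow> ('a \<Rightarrow> real) \<Rightarrow> ('a \<Rightarrow> real) \<Rightarrow> real" where
  "form m x y = (\<Sum>v\<in>V. adj x v * adj y v) - m * (\<Sum>v\<in>V. x v * y v)"

lemma adj_sum: "adj x v = (\<Sum>u\<in>V. if u \<in> N v then x u else 0)"
  unfolding adj_def using N_subset[of v]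
  by (simp add: sum.inter_restrict[OF finite_V, symmetric] Int_absorb1)

lemma adj_selfadjoint: "(\<Sum>v\<in>V. adj x v * y v) = (\<Sum>v\<in>V. x v * adj y v)"
proof -
  have "(\<Sum>v\<in>V. adj x v * y v) = (\<Sum>v\<in>V. \<Sum>u\<in>V. if u \<in> N v then x u * y v else 0)"
    unfolding adj_sum sum_distrib_right by (intro sum.cong) auto
  also have "\<dots> = (\<Sum>u\<in>V. \<Sum>v\<in>V. if u \<in> N v then x u * y v else 0)"
    by (rule sum.swap)
  also have "\<dots> = (\<Sum>u\<in>V. x u * adj y u)"
    unfolding adj_sum sum_distrib_left by (intro sum.cong) (auto simp: N_iff)
  finally show ?thesis .
qed

lemma adj_add: "adj (\<lambda>u. x u + y u) v = adj x v + adj y v"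
  by (simp add: adj_def sum.distrib)

lemma adj_scale: "adj (\<lambda>u. c * x u) v = c * adj x v"
  by (simp add: adj_def sum_distrib_left)

lemma form_commute: "form m x y = form m y x"
  by (simp add: form_def mult.commute)

lemma form_add: "form m (\<lambda>u. x u + y u) z = form m x z + form m y z"
  by (simp add: form_def adj_add sum.distrib algebra_simps)

lemma form_scale: "form m (\<lambda>u. c * x u) z = c * form m x z"
  by (simp add: form_def adj_scale sum_distrib_left algebra_simps)

text \<open>In a semidefinite form an isotropic vector lies in the radical: otherwise the form would
  be affine and nonconstant along y + c x, hence negative somewhere. The chosen c gives the value
  -1.\<close>

lemma form_null:
  assumes psd: "\<And>x. form m x x \<ge> 0" and null: "form m x x = 0"
  shows "form m x y = 0"
proof (rule ccontr)
  assume nz: "form m x y \<noteq> 0"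
  have expand: "form m (\<lambda>u. c * x u + y u) (\<lambda>u. c * x u + y u) = 2 * c * form m x y + form m y y" for c
    using null
    by (simp add: form_add form_scale form_commute[of m _ "\<lambda>u. c * x u + y u"] form_commute[of m y x])
  have "0 \<le> 2 * (- (form m y y + 1) / (2 * form m x y)) * form m x y + form m y y"
    using psd[of "\<lambda>u. - (form m y y + 1) / (2 * form m x y) * x u + y u"] unfolding expand .
  also have "\<dots> = -1"
    using nz by (simp add: field_simps)
  finally show False by simp
qed

definition ind :: "'a \<Rightarrow> 'a \<Rightarrow> real" where
  "ind p u = (if u = p then 1 else 0)"

lemma sum_ind: "v \<in> V \<Longrightarrow> (\<Sum>u\<in>V. f u * ind v u) = f v"
  using finite_V by (simp add: ind_def if_distrib[of "\<lambda>a. _ * a"] cong: if_cong)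

text \<open>Entry (u, v) of A^2 - I, since A^2 counts common neighbours. Integrality turns the later
  inequalities into case distinctions between 0 and 1.\<close>

definition gram :: "'a \<Rightarrow> 'a \<Rightarrow> int" where
  "gram u v = int (card (N u \<inter> N v)) - (if u = v then 1 else 0)"

lemma gram_commute: "gram u v = gram v u"
  by (simp add: gram_def Int_commute)

lemma adj_ind: "adj (ind p) v = (if p \<in> N v then 1 else 0)"
  by (simp add: adj_def ind_def)

lemma form_ind:
  assumes "p \<in> V" shows "form 1 (ind p) (ind q) = gram p q"
proof -
  have "(\<Sum>v\<in>V. adj (ind p) v * adj (ind q) v) = (\<Sum>v\<in>V. if v \<in> N p \<inter> N q then 1 else 0)"
    by (intro sum.cong) (auto simp: adj_ind N_iff)
  also have "\<dots> = card (N p \<inter> N q)"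
    using N_subset[of p] finite_V
    by (simp add: sum.If_cases) (metis Int_absorb1 le_infI1 Collect_mem_eq Int_def)
  finally have "(\<Sum>v\<in>V. adj (ind p) v * adj (ind q) v) = card (N p \<inter> N q)" .
  moreover have "(\<Sum>v\<in>V. ind p v * ind q v) = (if p = q then 1 else 0)"
    using assms finite_V by (simp add: ind_def if_distrib[of "\<lambda>a. a * _"] cong: if_cong)
  ultimately show ?thesis by (simp add: form_def gram_def)
qed

section \<open>The least eigenvalue of the squared adjacency matrix\<close>

lemma form_cong:
  assumes "\<And>v. v \<in> V \<Longrightarrow> x v = x' v" shows "form m x x = form m x' x'"
proof -
  have "adj x v = adj x' v" for v
    unfolding adj_def using assms N_subset by (intro sum.cong) auto
  then show ?thesis unfolding form_def using assms by simp
qed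

lemma adj_eq_iff_form:
  assumes "\<And>z. form m x z = 0" "v \<in> V"
  shows "adj (adj x) v = m * x v"
proof -
  have "(\<Sum>u\<in>V. adj x u * adj (ind v) u) = adj (adj x) v"
    unfolding adj_selfadjoint[symmetric, of "adj x"] using sum_ind[OF assms(2)] .
  moreover have "(\<Sum>u\<in>V. x u * ind v u) = x v" using sum_ind[OF assms(2)] .
  ultimately show ?thesis using assms(1)[of "ind v"] by (simp add: form_def)
qed

text \<open>Vectors are functions on the whole type; pinning the coordinates outside
  \<open>V\<close> to 0 makes the cube a product of compact sets, so that Tychonoff's theorem
  applies.\<close>

lemma compact_cube: "compact {x :: 'a \<Rightarrow> real. \<forall>v. x v \<in> (if v \<in> V then {-1..1} else {0})}"
proof -
  have "compactin (product_topology (\<lambda>_. euclidean) UNIV) (PiE UNIV (\<lambda>v. if v \<in> V then {-1..1::real} else {0}))"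
    by (subst compactin_PiE) (auto simp: compactin_euclidean_iff)
  moreover have "PiE UNIV (\<lambda>v. if v \<in> V then {-1..1::real} else {0}) =
      {x :: 'a \<Rightarrow> real. \<forall>v. x v \<in> (if v \<in> V then {-1..1} else {0})}"
    by (auto simp: PiE_UNIV_domain Pi_iff split: if_splits)
  ultimately show ?thesis by (simp add: euclidean_product_topology compactin_euclidean_iff)
qed

text \<open>Minimising |Ax|^2 on the unit sphere, a closed subset of the cube, produces the least
  eigenvalue m of A^2 and takes the place of the spectral theorem.\<close>

lemma form_minimiser:
  assumes "V \<noteq> {}"
  obtains y m where "(\<Sum>v\<in>V. (y v)\<^sup>2) = 1" "\<And>x. form m x x \<ge> 0" "form m y y = 0"
proof -
  let ?cube = "{x :: 'a \<Rightarrow> real. \<forall>v. x v \<in> (if v \<in> V then {-1..1} else {0})}"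
  let ?S = "?cube \<inter> {x. (\<Sum>v\<in>V. (x v)\<^sup>2) = 1}"
  have cont: "continuous_on A (\<lambda>x :: 'a \<Rightarrow> real. x v)" for A v
    by (rule continuous_on_subset[OF continuous_on_product_coordinates]) simp
  have "closed {x :: 'a \<Rightarrow> real. (\<Sum>v\<in>V. (x v)\<^sup>2) = 1}"
    by (intro closed_Collect_eq continuous_intros cont)
  then have compact: "compact ?S" by (rule compact_Int_closed[OF compact_cube])
  obtain p where p: "p \<in> V" using assms by blast
  then have "ind p \<in> ?S" using finite_V by (auto simp: ind_def if_distrib[of "\<lambda>t. t\<^sup>2"] cong: if_cong)
  then have "?S \<noteq> {}" by blast
  have "continuous_on ?S (\<lambda>x. \<Sum>v\<in>V. (adj x v)\<^sup>2)"
    unfolding adj_def by (intro continuous_intros cont)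
  from continuous_attains_inf[OF compact \<open>?S \<noteq> {}\<close> this]
  obtain y where y: "y \<in> ?S" and min: "\<And>x. x \<in> ?S \<Longrightarrow> (\<Sum>v\<in>V. (adj y v)\<^sup>2) \<le> (\<Sum>v\<in>V. (adj x v)\<^sup>2)"
    by blast
  define m where "m = (\<Sum>v\<in>V. (adj y v)\<^sup>2)"
  have "form m x x \<ge> 0" for x
  proof -
    define s where "s = (\<Sum>v\<in>V. (x v)\<^sup>2)"
    have "s \<ge> 0" unfolding s_def by (intro sum_nonneg) simp
    show ?thesis
    proof (cases "s = 0")
      case True
      then have "x v = 0" if "v \<in> V" for v
        using that sum_nonneg_eq_0_iff[OF finite_V, of "\<lambda>v. (x v)\<^sup>2"] unfolding s_def by simp
      then have "form m x x = form m (\<lambda>_. 0) (\<lambda>_. 0)" by (intro form_cong)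
      then show ?thesis by (simp add: form_def adj_def)
    next
      case False
      then have "s > 0" using \<open>s \<ge> 0\<close> by simp
      define z where "z v = (if v \<in> V then 1 / sqrt s * x v else 0)" for v
      have z2: "(\<Sum>v\<in>V. (z v)\<^sup>2) = 1"
        using \<open>s > 0\<close> by (simp add: z_def power_mult_distrib power_divide sum_divide_distrib[symmetric] s_def[symmetric])
      have "(z v)\<^sup>2 \<le> 1" if "v \<in> V" for v
        using member_le_sum[OF that, of "\<lambda>v. (z v)\<^sup>2"] finite_V z2 by simp
      then have "z v \<in> (if v \<in> V then {-1..1} else {0})" for v
        by (auto simp: abs_square_le_1 abs_le_iff) (auto simp: z_def)
      then have "z \<in> ?S" using z2 by blast
      then have "form m z z \<ge> 0" using min z2 by (simp add: form_def m_def power2_eq_square)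
      also have "form m z z = form m (\<lambda>v. 1 / sqrt s * x v) (\<lambda>v. 1 / sqrt s * x v)"
        by (intro form_cong) (simp add: z_def)
      also have "\<dots> = 1 / s * form m x x"
        using \<open>s > 0\<close> by (simp only: form_scale form_commute[of m x "\<lambda>v. 1 / sqrt s * x v"]) (simp add: field_simps)
      finally show ?thesis using \<open>s > 0\<close> by (simp add: zero_le_divide_iff)
    qed
  qed
  moreover have "(\<Sum>v\<in>V. (y v)\<^sup>2) = 1" using y by blast
  moreover from this have "form m y y = 0" by (simp add: form_def m_def power2_eq_square)
  ultimately show ?thesis using that by blast
qed

lemma adj_eigenvalueI:
  assumes G: "verts G = V" "arcs_ends G = {(u, v). v \<in> N u}"
    and x: "p \<in> V" "x p \<noteq> 0" and eig: "\<And>v. v \<in> V \<Longrightarrow> adj x v = k * x v"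
  shows "adj_eigenvalue G k"
proof -
  obtain vs where vs: "distinct vs" "set vs = V" using finite_distinct_list[OF finite_V] by blast
  let ?n = "length vs"
  define w where "w = Matrix.vec ?n (\<lambda>i. x (vs ! i))"
  have bij: "bij_betw ((!) vs) {0..<?n} V" using vs by (intro bij_betw_nth) auto
  obtain i where "i < ?n" "vs ! i = p" using x(1) vs(2) by (metis in_set_conv_nth)
  then have "w \<noteq> 0\<^sub>v ?n" using x(2) by (auto simp: w_def dest: arg_cong[where f = "\<lambda>w. vec_index w i"])
  moreover have "adj_mat G vs *\<^sub>v w = k \<cdot>\<^sub>v w"
  proof (rule eq_vecI)
    fix i assume "i < dim_vec (k \<cdot>\<^sub>v w)"
    then have i: "i < ?n" by (simp add: w_def)
    have "vec_index (adj_mat G vs *\<^sub>v w) i = (\<Sum>j\<in>{0..<?n}. if vs ! j \<in> N (vs ! i) then x (vs ! j) else 0)"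
      using i by (auto simp: adj_mat_def w_def G scalar_prod_def intro!: sum.cong)
    also have "\<dots> = (\<Sum>u\<in>V. if u \<in> N (vs ! i) then x u else 0)"
      by (rule sum.reindex_bij_betw[OF bij])
    also have "\<dots> = k * x (vs ! i)" using eig[OF nth_mem[OF i, unfolded vs(2)]] by (simp add: adj_sum)
    finally show "vec_index (adj_mat G vs *\<^sub>v w) i = vec_index (k \<cdot>\<^sub>v w) i" using i by (simp add: w_def)
  qed (simp add: adj_mat_def w_def)
  ultimately have "eigenvector (adj_mat G vs) w k"
    by (simp add: eigenvector_def adj_mat_def w_def)
  then show ?thesis unfolding adj_eigenvalue_def eigenvalue_def using vs G by blast
qed

text \<open>If m < 1, a minimiser y satisfies (A - r)(A + r) y = 0 with r = sqrt m. Either (A + r) y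
  is an eigenvector for r, or it vanishes and y is one for -r; both values lie in the forbidden
  gap.\<close>

lemma form_nonneg:
  assumes G: "verts G = V" "arcs_ends G = {(u, v). v \<in> N u}"
    and gap: "\<not> (\<exists>x. adj_eigenvalue G x \<and> -1 < x \<and> x < 1)"
  shows "form 1 x x \<ge> 0"
proof (cases "V = {}")
  case False
  then obtain y m where y: "(\<Sum>v\<in>V. (y v)\<^sup>2) = 1" "\<And>x. form m x x \<ge> 0" "form m y y = 0"
    using form_minimiser by metis
  have "m = (\<Sum>v\<in>V. (adj y v)\<^sup>2)" using y(1,3) by (simp add: form_def power2_eq_square)
  then have "m \<ge> 0" by (simp add: sum_nonneg)
  have "m \<ge> 1"
  proof (rule ccontr)
    assume "\<not> m \<ge> 1"
    then have r: "-1 < sqrt m" "sqrt m < 1" using \<open>m \<ge> 0\<close> by (auto intro: less_le_trans[of _ 0])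
    have sq: "adj (adj y) v = m * y v" if "v \<in> V" for v
      using adj_eq_iff_form[OF form_null[OF y(2,3)] that] .
    define w where "w v = adj y v + sqrt m * y v" for v
    have w: "adj w v = sqrt m * w v" if "v \<in> V" for v
      using sq[OF that] \<open>m \<ge> 0\<close> unfolding w_def adj_add adj_scale by (simp add: algebra_simps)
    show False
    proof (cases "\<exists>p\<in>V. w p \<noteq> 0")
      case True
      then show False using adj_eigenvalueI[OF G _ _ w] gap r by blast
    next
      case False
      then have "adj y v = - sqrt m * y v" if "v \<in> V" for v using that by (auto simp: w_def)
      moreover have "\<exists>p\<in>V. y p \<noteq> 0" using y(1) by (auto intro: ccontr)
      ultimately have "adj_eigenvalue G (- sqrt m)" using adj_eigenvalueI[OF G] by blast
      moreover have "-1 < - sqrt m" "- sqrt m < 1" using r by linarith+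
      ultimately show False using gap by blast
    qed
  qed
  have "form m x x \<le> form 1 x x"
    using mult_right_mono[OF \<open>m \<ge> 1\<close>, of "\<Sum>v\<in>V. x v * x v"] by (simp add: form_def sum_nonneg)
  then show ?thesis using y(2)[of x] by linarith
next
  case True
  then show ?thesis unfolding form_def by simp
qed

end

section \<open>Linear relations around a vertex of degree 2\<close>

locale expanding_subcubic = neighbourhoods +
  fixes side :: "'a \<Rightarrow> bool"
  assumes N_side: "u \<in> N v \<Longrightarrow> side u \<noteq> side v"
    and linear: "\<lbrakk>c \<in> N u; c \<in> N v; d \<in> N u; d \<in> N v; u \<noteq> v\<rbrakk> \<Longrightarrow> c = d"
    and degree: "v \<in> V \<Longrightarrow> card (N v) = 2 \<or> card (N v) = 3"
    and psd: "form 1 x x \<ge> 0"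
    and connected: "\<lbrakk>S \<subseteq> V; S \<noteq> {}; \<And>v. v \<in> S \<Longrightarrow> N v \<subseteq> S\<rbrakk> \<Longrightarrow> S = V"
begin

lemma gram_self: "gram u u = int (card (N u)) - 1"
  by (simp add: gram_def)

lemma gram_1:
  assumes "c \<in> N u" "c \<in> N v" "u \<noteq> v" shows "gram u v = 1"
proof -
  have "N u \<inter> N v = {c}" using assms linear by blast
  then show ?thesis using assms by (simp add: gram_def)
qed

lemma gram_0: "N u \<inter> N v = {} \<Longrightarrow> u \<noteq> v \<Longrightarrow> gram u v = 0"
  by (simp add: gram_def)

lemma gram_pos: "gram u v = 1 \<Longrightarrow> u \<noteq> v \<Longrightarrow> \<exists>c. c \<in> N u \<and> c \<in> N v"
  using gram_0 by fastforce

lemma gram_bounds: "u \<noteq> v \<Longrightarrow> 0 \<le> gram u v \<and> gram u v \<le> 1"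
  using gram_1 gram_0 by (cases "N u \<inter> N v = {}") fastforce+

text \<open>Semidefiniteness and \<open>form_null\<close> for an integer combination of vertices.
  Four terms cover every relation below; shorter combinations repeat a vertex with coefficient
  0.\<close>

lemma gram_quadratic:
  fixes a b c d :: int
  assumes "p \<in> V" "q \<in> V" "r \<in> V" "s \<in> V"
  defines "Q \<equiv> a * (a * gram p p + b * gram p q + c * gram p r + d * gram p s)
     + b * (a * gram q p + b * gram q q + c * gram q r + d * gram q s)
     + c * (a * gram r p + b * gram r q + c * gram r r + d * gram r s)
     + d * (a * gram s p + b * gram s q + c * gram s r + d * gram s s)"
  shows gram_nonneg: "0 \<le> Q"
    and gram_null: "Q = 0 \<Longrightarrow> a * gram p z + b * gram q z + c * gram r z + d * gram s z = 0"
proof -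
  define x where
    "x = (\<lambda>u. real_of_int a * ind p u + (real_of_int b * ind q u + (real_of_int c * ind r u + real_of_int d * ind s u)))"
  have fx: "form 1 x y = a * form 1 (ind p) y + b * form 1 (ind q) y + c * form 1 (ind r) y + d * form 1 (ind s) y" for y
    unfolding x_def by (simp only: form_add form_scale add.assoc)
  have xz: "form 1 x (ind z) = real_of_int (a * gram p z + b * gram q z + c * gram r z + d * gram s z)" for z
    unfolding fx using assms(1-4) by (simp add: form_ind)
  have "form 1 x x = a * form 1 x (ind p) + b * form 1 x (ind q) + c * form 1 x (ind r) + d * form 1 x (ind s)"
    unfolding fx[of x] by (simp add: form_commute)
  also have "\<dots> = real_of_int Q"
    unfolding xz Q_def by (simp add: gram_commute)
  finally have xx: "form 1 x x = real_of_int Q" .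
  show "0 \<le> Q" using psd[of x] xx by simp
  assume "Q = 0"
  then have "form 1 x (ind z) = 0" using form_null[OF psd] xx by simp
  then show "a * gram p z + b * gram q z + c * gram r z + d * gram s z = 0"
    unfolding xz by linarith
qed

lemma gram_twins:
  assumes "card (N u) = 2" "card (N v) = 2" "c \<in> N u" "c \<in> N v"
  shows "gram u z = gram v z"
proof (cases "u = v")
  case False
  have "gram u v = 1" "gram v u = 1" "gram u u = 1" "gram v v = 1"
    using assms False by (auto simp: gram_self intro: gram_1)
  then show ?thesis
    using gram_null[of u v u v 1 "-1" 0 0 z] N_V assms by auto
qed simp

lemma obtain_2:
  assumes "card (N v) = 2" "a \<in> N v"
  obtains b where "N v = {a, b}" "b \<noteq> a"
  using assms by (metis card_2_iff doubleton_eq_iff insertE singletonD)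

lemma obtain_3:
  assumes "card (N v) = 3" "a \<in> N v" "b \<in> N v" "a \<noteq> b"
  obtains c where "N v = {a, b, c}" "c \<noteq> a" "c \<noteq> b"
proof -
  have "card (N v - {a, b}) = 1" using assms by (simp add: card_Diff_subset)
  then obtain c where "N v - {a, b} = {c}" by (auto simp: card_1_singleton_iff)
  then have "N v = {a, b, c}" "c \<noteq> a" "c \<noteq> b" using assms by blast+
  then show ?thesis using that by blast
qed

lemma obtain_other:
  assumes "a \<in> N v"
  obtains b where "b \<in> N v" "b \<noteq> a"
proof -
  have "2 \<le> card (N v)" using assms degree N_V by fastforce
  then have "N v \<noteq> {a}" by auto
  then show ?thesis using assms that by blast
qed

lemma card_3I:
  assumes "a \<in> N v" "b \<in> N v" "c \<in> N v" "a \<noteq> b" "a \<noteq> c" "b \<noteq> c"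
  shows "card (N v) = 3" "N v = {a, b, c}"
proof -
  have "card {a, b, c} \<le> card (N v)" using assms by (intro card_mono) auto
  then show *: "card (N v) = 3" using assms degree[of v] N_V by fastforce
  show "N v = {a, b, c}"
    using assms * by (intro card_subset_eq[symmetric]) auto
qed

lemma long_or_short: "c \<in> N v \<Longrightarrow> card (N v) \<noteq> 2 \<Longrightarrow> card (N v) = 3"
  using degree N_V by blast

text \<open>
  If q and s had no common neighbour, they would have degree 3 and q + s - 2p would be a null vector, so
  each of the two further neighbours of q would share a vertex other than p, s with b2.
\<close>

lemma square:
  assumes p: "N p = {b1, b2}" "b1 \<noteq> b2"
    and q: "q \<in> N b1" "q \<noteq> p" and s: "s \<in> N b2" "s \<noteq> p"
  shows "N q \<inter> N s \<noteq> {}"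
proof
  assume disj: "N q \<inter> N s = {}"
  have mem: "b1 \<in> N q" "b1 \<in> N p" "b2 \<in> N s" "b2 \<in> N p" "p \<in> N b1" "p \<in> N b2"
    using p q s by (auto simp: N_iff)
  have "q \<noteq> s" using disj mem by auto
  have g: "gram p p = 1" "gram p q = 1" "gram q p = 1" "gram p s = 1" "gram s p = 1"
      "gram q s = 0" "gram s q = 0"
    using p q s mem disj \<open>q \<noteq> s\<close>
    by (auto simp: gram_self Int_commute intro: gram_1 gram_0)
  \<comment> \<open>If \<open>q\<close> were short, it would have the same vector as
    \<open>p\<close>, and its inner product with \<open>s\<close> would be 1.\<close>
  have "card (N q) \<noteq> 2" "card (N s) \<noteq> 2"
    using gram_twins[of p q b1 s] gram_twins[of p s b2 q] mem g p q s by auto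
  then have long: "card (N q) = 3" "card (N s) = 3"
    using mem long_or_short by blast+
  have V: "p \<in> V" "q \<in> V" "s \<in> V" using mem N_V by blast+
  have null: "gram q z + gram s z = 2 * gram p z" for z
    using gram_null[of q s p p 1 1 "-2" 0 z] V g long by (simp add: gram_self)
  obtain c1 c2 where c: "N q = {b1, c1, c2}" "c1 \<noteq> b1" "c2 \<noteq> b1" "c1 \<noteq> c2"
  proof -
    obtain c1 where "c1 \<in> N q" "c1 \<noteq> b1" using obtain_other[OF mem(1)] by blast
    then show ?thesis using obtain_3[OF long(1) mem(1), of c1] that by metis
  qed
  have "\<exists>z. z \<in> N c \<and> z \<noteq> q \<and> z \<in> N b2 \<and> z \<noteq> p \<and> z \<noteq> s" if "c \<in> N q" "c \<noteq> b1" for c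
  proof -
    have "q \<in> N c" using that N_iff by blast
    then obtain z where z: "z \<in> N c" "z \<noteq> q" using obtain_other by blast
    have cz: "c \<in> N z" using z N_iff by blast
    have "gram q z = 1" using gram_1 that cz z by metis
    have "z \<noteq> s" using disj that cz by blast
    have "z \<noteq> p"
      using that cz mem p linear[of c z q b1] q by auto
    have "b1 \<notin> N z" using linear[of c z q b1] cz that mem z by blast
    have "gram p z \<noteq> 0" using null[of z] gram_bounds[of s z] \<open>z \<noteq> s\<close> \<open>gram q z = 1\<close> by auto
    then have "N p \<inter> N z \<noteq> {}" using gram_0 \<open>z \<noteq> p\<close> by blast
    then have "b2 \<in> N z" using p \<open>b1 \<notin> N z\<close> by auto
    then show ?thesis using z \<open>z \<noteq> s\<close> \<open>z \<noteq> p\<close> N_iff by blast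
  qed
  from this[of c1] this[of c2] obtain z1 z2 where
    z: "z1 \<in> N c1" "z1 \<noteq> q" "z1 \<in> N b2" "z1 \<noteq> p" "z1 \<noteq> s"
       "z2 \<in> N c2" "z2 \<noteq> q" "z2 \<in> N b2" "z2 \<noteq> p" "z2 \<noteq> s"
    using c by blast
  \<comment> \<open>\<open>b2\<close> has room for one vertex besides \<open>p\<close> and
    \<open>s\<close>, so \<open>c1\<close> and \<open>c2\<close> would join \<open>q\<close> to the
    same vertex.\<close>
  have "z1 = z2" using card_3I(2)[of z1 b2 p s] z mem s by auto
  then show False
    using linear[of c1 z1 q c2] z c by (auto simp: N_iff)
qed

text \<open>The vector t - q - s + 2p has squared norm deg(t) - 3.\<close>

lemma opposite:
  assumes p: "card (N p) = 2" and q: "card (N q) = 3" and s: "card (N s) = 3"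
    and pq: "gram p q = 1" "p \<noteq> q" and ps: "gram p s = 1" "p \<noteq> s" and qs: "gram q s = 1" "q \<noteq> s"
    and t: "gram t q = 1" "t \<noteq> q" "gram t s = 1" "t \<noteq> s" "gram t p = 0"
  shows opposite_degree: "card (N t) = 3"
    and opposite_gram: "gram t z = gram q z + gram s z - 2 * gram p z"
proof -
  have V: "p \<in> V" "q \<in> V" "s \<in> V" "t \<in> V"
    using gram_pos[OF pq] gram_pos[OF qs] gram_pos[OF t(1,2)] N_V by blast+
  have g: "gram p p = 1" "gram q q = 2" "gram s s = 2" "gram q p = 1" "gram s p = 1" "gram s q = 1"
      "gram q t = 1" "gram s t = 1" "gram p t = 0"
    using assms gram_commute[of q p] gram_commute[of s p] gram_commute[of s q] gram_commute[of q t]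
      gram_commute[of s t] gram_commute[of p t] by (auto simp: gram_self)
  have "2 \<le> gram t t"
    using gram_nonneg[of t q s p 1 "-1" "-1" 2] V g pq ps qs t by simp
  then show t3: "card (N t) = 3" using V degree[of t] by (auto simp: gram_self)
  then have "gram t t = 2" by (simp add: gram_self)
  then show "gram t z = gram q z + gram s z - 2 * gram p z"
    using gram_null[of t q s p 1 "-1" "-1" 2 z] V g pq ps qs t by simp
qed

section \<open>Every vertex of degree 2 has a neighbour of degree 2\<close>

lemma linear_dual: "\<lbrakk>u \<in> N c; v \<in> N c; u \<in> N d; v \<in> N d; u \<noteq> v\<rbrakk> \<Longrightarrow> c = d"
  using linear[of c u v d] by (simp add: N_iff)

lemma gram_1_dual: "\<lbrakk>u \<in> N c; v \<in> N c; u \<noteq> v\<rbrakk> \<Longrightarrow> gram u v = 1"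
  using gram_1[of c u v] by (simp add: N_iff)

lemma gram_0_dual: "\<lbrakk>gram u v = 0; u \<in> N c; v \<in> N c\<rbrakk> \<Longrightarrow> u = v"
  using gram_1_dual by fastforce

lemma gram_0I:
  assumes "u \<noteq> v" "\<And>c. c \<in> N u \<Longrightarrow> v \<notin> N c" shows "gram u v = 0"
  using assms by (intro gram_0) (auto simp: N_iff)

lemma gram_cases: "u \<noteq> v \<Longrightarrow> gram u v = 0 \<or> gram u v = 1 \<and> (\<exists>c\<in>N u. v \<in> N c)"
  using gram_0I[of u v] gram_1[of _ u v] by (auto simp: N_iff)

text \<open>The typical use of \<open>opposite\<close>: \<open>q\<close> and \<open>s\<close> meet
  in a block \<open>c\<close>, and a further vertex \<open>t\<close> of \<open>c\<close> misses both
  blocks of \<open>p\<close> because two blocks share at most one vertex. Inner products with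
  \<open>t\<close> are from here on computed from those with \<open>q\<close>, \<open>s\<close> and
  \<open>p\<close>.\<close>

lemma fourth_point:
  assumes p: "N p = {b1, b2}" "b1 \<noteq> b2"
    and q: "q \<in> N b1" "q \<noteq> p" "card (N q) = 3" and s: "s \<in> N b2" "s \<noteq> p" "card (N s) = 3"
    and c: "q \<in> N c" "s \<in> N c" and t: "t \<in> N c" "t \<noteq> q" "t \<noteq> s"
  shows fourth_point_degree: "card (N t) = 3"
    and fourth_point_gram: "gram t z = gram q z + gram s z - 2 * gram p z"
    and fourth_point_zero: "gram t p = 0"
    and fourth_point_neq: "t \<noteq> p"
proof -
  have mem: "p \<in> N b1" "p \<in> N b2" using p by (auto simp: N_iff)
  have "q \<noteq> s" using linear_dual mem p(2) q s by metis
  have "b1 \<noteq> c" "b2 \<noteq> c"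
    using linear_dual mem p(2) q s c by metis+
  then have no: "t \<notin> N b1" "t \<notin> N b2"
    using linear_dual t q s c by metis+
  then show "t \<noteq> p" using mem by auto
  then show 0: "gram t p = 0"
    using gram_0I[of p t] p no by (auto simp: gram_commute)
  have g: "gram p q = 1" "gram p s = 1" "gram q s = 1" "gram t q = 1" "gram t s = 1"
    using gram_1_dual mem q s c t \<open>q \<noteq> s\<close> by metis+
  have "card (N p) = 2" using p by simp
  note o = this q(3) s(3) g(1) q(2)[symmetric] g(2) s(2)[symmetric] g(3) \<open>q \<noteq> s\<close> g(4) t(2) g(5) t(3) 0
  show "card (N t) = 3" "gram t z = gram q z + gram s z - 2 * gram p z"
    by (rule opposite_degree[OF o], rule opposite_gram[OF o])
qed

text \<open>This is \<open>square\<close> on the other side: if \<open>c11\<close> were short,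
  \<open>c12\<close> and \<open>c21\<close> would share a vertex \<open>x\<close>. As a fourth point
  on \<open>c12\<close>, it has inner product at most 1 + 1 - 2 = 0 with \<open>q2\<close>, yet both
  lie on \<open>c21\<close>.\<close>

lemma grid_block:
  assumes p: "N p = {b1, b2}" "b1 \<noteq> b2"
    and q: "q1 \<in> N b1" "q2 \<in> N b1" "q1 \<noteq> p" "q2 \<noteq> p" "q1 \<noteq> q2" "card (N q1) = 3"
    and s: "s1 \<in> N b2" "s2 \<in> N b2" "s1 \<noteq> p" "s2 \<noteq> p" "s1 \<noteq> s2" "card (N s2) = 3"
    and c: "q1 \<in> N c11" "s1 \<in> N c11" "q1 \<in> N c12" "s2 \<in> N c12" "q2 \<in> N c21" "s1 \<in> N c21"
  shows "card (N c11) = 3"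
proof (rule ccontr)
  assume "card (N c11) \<noteq> 3"
  then have c2: "card (N c11) = 2" using long_or_short c(1) by blast
  have mem: "p \<in> N b1" "p \<in> N b2" using p by (auto simp: N_iff)
  have nb: "q1 \<notin> N b2" "q2 \<notin> N b2" "s1 \<notin> N b1" "s2 \<notin> N b1"
    using linear_dual mem p(2) q s by metis+
  have "q1 \<noteq> s1" "s1 \<noteq> q2" "s2 \<noteq> q2" using nb q s by auto
  obtain z where "N c11 = {q1, z}" using obtain_2[OF c2 c(1)] .
  then have "N c11 = {q1, s1}"
    using c(2) \<open>q1 \<noteq> s1\<close> by auto
  moreover have "c11 \<noteq> c12" using linear_dual c s nb by metis
  moreover have "c11 \<noteq> c21" using linear_dual c q nb by metis
  ultimately have "N c12 \<inter> N c21 \<noteq> {}"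
    using square[of c11 q1 s1 c12 c21] \<open>q1 \<noteq> s1\<close> c N_sym by metis
  then obtain x where x: "x \<in> N c12" "x \<in> N c21" by blast
  have "x \<noteq> q1" using linear_dual c q s nb x by metis
  have "x \<noteq> s2" using linear_dual c q s nb x by metis
  have "x \<noteq> q2" using linear_dual c q s nb x by metis
  have "gram x q2 = gram q1 q2 + gram s2 q2 - 2 * gram p q2"
    using fourth_point_gram[OF p q(1,3,6) s(2,4,6) c(3,4) x(1) \<open>x \<noteq> q1\<close> \<open>x \<noteq> s2\<close>] .
  moreover have "gram q1 q2 = 1" "gram p q2 = 1" "gram x q2 = 1"
    using gram_1_dual mem q c x \<open>x \<noteq> q2\<close> by metis+
  moreover have "gram s2 q2 \<le> 1" using gram_bounds \<open>s2 \<noteq> q2\<close> by blast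
  ultimately show False by simp
qed

text \<open>
  If both neighbours of p had degree 3, the vertices q1, q2, s1, s2 at distance 2 from p would form a
  2 by 2 grid with blocks c11, c12, c21, c22 of size 3. The remaining vertices t1, t2 of c11, c12 have a
  common neighbour e of degree 2, at which the square property fails.
\<close>

lemma short_neighbour:
  assumes "card (N p) = 2"
  shows "\<exists>b\<in>N p. card (N b) = 2"
proof (rule ccontr)
  assume neg: "\<not> ?thesis"
  obtain b1 b2 where p: "N p = {b1, b2}" "b1 \<noteq> b2" using assms by (auto simp: card_2_iff)
  have mem: "p \<in> N b1" "p \<in> N b2" using p by (auto simp: N_iff)
  have b: "card (N b1) = 3" "card (N b2) = 3" using neg p mem long_or_short by blast+
  obtain q1 where "q1 \<in> N b1" "q1 \<noteq> p" using obtain_other mem by blast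
  then obtain q2 where q: "N b1 = {p, q1, q2}" "q1 \<noteq> p" "q2 \<noteq> p" "q1 \<noteq> q2"
    using obtain_3[OF b(1) mem(1), of q1] by metis
  obtain s1 where "s1 \<in> N b2" "s1 \<noteq> p" using obtain_other mem by blast
  then obtain s2 where s: "N b2 = {p, s1, s2}" "s1 \<noteq> p" "s2 \<noteq> p" "s1 \<noteq> s2"
    using obtain_3[OF b(2) mem(2), of s1] by metis
  have qb: "q1 \<in> N b1" "q2 \<in> N b1" and sb: "s1 \<in> N b2" "s2 \<in> N b2" using q s by auto
  have nb: "q1 \<notin> N b2" "q2 \<notin> N b2" "s1 \<notin> N b1" "s2 \<notin> N b1"
    using linear_dual mem p(2) q(2-4) s(2-4) qb sb by metis+
  have sq: "\<exists>c. x \<in> N c \<and> y \<in> N c" if "x \<in> {q1, q2}" "y \<in> {s1, s2}" for x y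
  proof -
    have "N x \<inter> N y \<noteq> {}" using square[OF p, of x y] that q s by auto
    then show ?thesis using N_sym by blast
  qed
  obtain c11 where c11: "q1 \<in> N c11" "s1 \<in> N c11" using sq by blast
  obtain c12 where c12: "q1 \<in> N c12" "s2 \<in> N c12" using sq by blast
  obtain c21 where c21: "q2 \<in> N c21" "s1 \<in> N c21" using sq by blast
  obtain c22 where c22: "q2 \<in> N c22" "s2 \<in> N c22" using sq by blast
  have ne: "c11 \<noteq> c12" "c11 \<noteq> c21" "c12 \<noteq> c22" "c21 \<noteq> c22"
    using linear_dual c11 c12 c21 c22 qb sb q(4) s(4) nb by metis+
  have neb: "b1 \<noteq> c11" "b2 \<noteq> c11" "b1 \<noteq> c12" "b2 \<noteq> c12" "b1 \<noteq> c21" "b2 \<noteq> c21" "b1 \<noteq> c22" "b2 \<noteq> c22"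
    using c11 c12 c21 c22 nb by metis+
  have N4: "N q1 = {b1, c11, c12}" "card (N q1) = 3" "N q2 = {b1, c21, c22}" "card (N q2) = 3"
     "N s1 = {b2, c11, c21}" "card (N s1) = 3" "N s2 = {b2, c12, c22}" "card (N s2) = 3"
    using card_3I[of b1 q1 c11 c12] card_3I[of b1 q2 c21 c22] card_3I[of b2 s1 c11 c21]
      card_3I[of b2 s2 c12 c22] qb sb c11 c12 c21 c22 ne neb N_sym by metis+
  have "card (N c11) = 3"
    using grid_block[OF p qb q(2-4) N4(2) sb s(2-4) N4(8) c11 c12 c21] .
  then obtain t1 where t1: "N c11 = {q1, s1, t1}" "t1 \<noteq> q1" "t1 \<noteq> s1"
    using obtain_3[of c11 q1 s1] c11 qb nb by metis
  have "card (N c12) = 3"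
    using grid_block[OF p qb q(2-4) N4(2) sb(2,1) s(3,2) s(4)[symmetric] N4(6) c12 c11 c22] .
  then obtain t2 where t2: "N c12 = {q1, s2, t2}" "t2 \<noteq> q1" "t2 \<noteq> s2"
    using obtain_3[of c12 q1 s2] c12 qb nb by metis
  have tc: "t1 \<in> N c11" "t2 \<in> N c12" using t1 t2 by auto
  note f1 = p qb(1) q(2) N4(2) sb(1) s(2) N4(6) c11 tc(1) t1(2,3)
  note f2 = p qb(1) q(2) N4(2) sb(2) s(3) N4(8) c12 tc(2) t2(2,3)
  have g: "gram q1 s1 = 1" "gram q1 s2 = 1" "gram q2 s1 = 1" "gram q2 s2 = 1" "gram q1 q2 = 1" "gram q2 q1 = 1"
    "gram s1 s2 = 1" "gram s2 s1 = 1" "gram p q1 = 1" "gram p q2 = 1" "gram p s1 = 1" "gram p s2 = 1"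
    "gram s1 q2 = 1" "gram q1 t2 = 1"
    using gram_1_dual c11 c12 c21 c22 mem q(2-4) s(2-4) qb sb nb t2(2) tc by metis+
  \<comment> \<open>Any two of \<open>p\<close>, \<open>q1\<close>, \<open>q2\<close>,
    \<open>s1\<close>, \<open>s2\<close> share a block, so each of these values is 1 + 1 -
    2.\<close>
  have g1: "gram t1 s2 = 0" "gram t1 q2 = 0" and g2: "gram t2 s1 = 0"
    using fourth_point_gram[OF f1, of s2] fourth_point_gram[OF f1, of q2]
      fourth_point_gram[OF f2, of s1] g by auto
  have t12: "gram t1 t2 = 1"
    using fourth_point_gram[OF f1, of t2] g g2 fourth_point_zero[OF f2]
      gram_commute[of s1 t2] gram_commute[of p t2] by simp
  then have "t1 \<noteq> t2" using fourth_point_degree[OF f1] by (auto simp: gram_self)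
  then obtain e where e: "t1 \<in> N e" "t2 \<in> N e" using gram_pos[OF t12] N_sym by blast
  have "e \<noteq> c11" using linear_dual c11 c12 e tc t2(2) ne by metis
  have "e \<noteq> c12" using linear_dual c11 c12 e tc t1(2) ne by metis
  \<comment> \<open>A third vertex \<open>z\<close> of \<open>e\<close> is orthogonal to
    \<open>q1\<close> and \<open>p\<close>, so the formula for \<open>t1\<close> puts it on a block
    with \<open>s1\<close>, namely \<open>c21\<close>. There \<open>z\<close> is itself a fourth
    point, orthogonal to \<open>s2\<close>, and the formula for \<open>t2\<close> gives 0 instead of
    1.\<close>
  have Ne: "z = t1 \<or> z = t2" if z: "z \<in> N e" for z
  proof (rule ccontr)
    assume nz: "\<not> (z = t1 \<or> z = t2)"
    then have gz: "gram t1 z = 1" "gram t2 z = 1" using gram_1_dual e z by blast+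
    have nc: "z \<notin> N c11" "z \<notin> N c12"
      using linear_dual nz z e tc \<open>e \<noteq> c11\<close> \<open>e \<noteq> c12\<close> by metis+
    then have ns: "z \<noteq> q1" "z \<noteq> s1" "z \<noteq> s2" "z \<noteq> q2" "z \<noteq> p"
      using c11 c12 gz g1 fourth_point_zero[OF f1] by auto
    then have "z \<notin> N b1" "z \<notin> N b2" using q s by auto
    then have "gram q1 z = 0" "gram p z = 0"
      using gram_0I[of q1 z] gram_0I[of p z] ns nc N4 p by auto
    then have "gram s1 z = 1"
      using fourth_point_gram[OF f1, of z] gz by simp
    then have "z \<in> N c21"
      using gram_cases[of s1 z] ns nc N4 \<open>z \<notin> N b2\<close> by auto
    then have "gram z s2 = gram q2 s2 + gram s1 s2 - 2 * gram p s2"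
      using fourth_point_gram[OF p qb(2) q(3) N4(4) sb(1) s(2) N4(6) c21, of z s2] ns by auto
    then have "gram s2 z = 0" using g gram_commute[of s2 z] by simp
    then show False
      using fourth_point_gram[OF f2, of z] gz \<open>gram q1 z = 0\<close> \<open>gram p z = 0\<close> by simp
  qed
  then have Ne: "N e = {t1, t2}" using e by blast
  have "card (N t2) = 3" using fourth_point_degree[OF f2] .
  then obtain e' where e': "N t2 = {e, c12, e'}" "e' \<noteq> e" "e' \<noteq> c12"
    using obtain_3[of t2 e c12] e tc \<open>e \<noteq> c12\<close> N_sym by metis
  have t2e': "t2 \<in> N e'" using e' by (auto simp: N_iff)
  \<comment> \<open>\<open>square\<close> at the short block \<open>e\<close> requires a common
    vertex of \<open>c11\<close> and the third block \<open>e'\<close> of \<open>t2\<close>; none of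
    \<open>q1\<close>, \<open>s1\<close>, \<open>t1\<close> can be it.\<close>
  have "N c11 \<inter> N e' \<noteq> {}"
    using square[OF Ne \<open>t1 \<noteq> t2\<close>, of c11 e'] tc(1) \<open>e \<noteq> c11\<close> e'(2) t2e' N_sym by metis
  then obtain y where y: "y \<in> N c11" "y \<in> N e'" by blast
  have "y \<noteq> t1" using linear_dual e y t2e' e'(2) \<open>t1 \<noteq> t2\<close> by metis
  moreover have "y \<noteq> q1" using linear_dual y t2e' tc c12 t2(2) e'(3) by metis
  moreover have "y \<noteq> s1"
    using gram_0_dual[OF g2] t2e' y linear_dual c11 c12 tc t1(2) t2(2) ne sb s(4) nb by metis
  ultimately show False using y t1 by auto
qed

section \<open>Local structures\<close>

lemma square_dual:
  assumes "N p = {b1, b2}" "b1 \<noteq> b2" "q \<in> N b1" "q \<noteq> p" "s \<in> N b2" "s \<noteq> p"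
  obtains c where "q \<in> N c" "s \<in> N c"
  using square[OF assms] N_sym by blast

lemma card_2I: "\<lbrakk>card (N v) = 2; a \<in> N v; b \<in> N v; a \<noteq> b\<rbrakk> \<Longrightarrow> N v = {a, b}"
  by (metis obtain_2 insertE singletonD)

lemma N_symD: "N v = S \<Longrightarrow> u \<in> S \<Longrightarrow> v \<in> N u"
  using N_sym by blast

text \<open>By \<open>square\<close> at the short vertex \<open>b\<close>, a third neighbour
  \<open>c'\<close> of \<open>q\<close> would share a vertex with \<open>b2\<close>, hence be
  adjacent to \<open>p\<close> or \<open>s\<close>. Either closes a 4-cycle through
  \<open>q\<close>.\<close>

lemma hexagon_end:
  assumes p: "N p = {b, b2}" "b \<noteq> b2" and b: "N b = {p, q}" "p \<noteq> q" and b2: "N b2 = {p, s}" "p \<noteq> s"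
    and c: "q \<in> N c" "s \<in> N c"
  shows "N q = {b, c}"
proof -
  have mem: "p \<in> N b" "p \<in> N b2" "q \<in> N b" "s \<in> N b2" using b b2 by auto
  have "q \<noteq> s" using linear_dual mem p(2) b(2) by metis
  have "b \<noteq> c" using linear_dual mem p(2) b(2) c b2(2) by metis
  have "c' = b \<or> c' = c" if c': "c' \<in> N q" for c'
  proof (rule ccontr)
    assume ne: "\<not> (c' = b \<or> c' = c)"
    then obtain y where y: "b2 \<in> N y" "c' \<in> N y"
      using square_dual[OF b, of b2 c'] c' mem p(2) N_sym by metis
    then have "y = p \<or> y = s" using N_sym[OF y(1)] b2 by auto
    then show False
      using linear_dual[of q c' p b] linear_dual[of q c' s c] y c' ne mem c b(2) \<open>q \<noteq> s\<close> N_sym by metis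
  qed
  then show ?thesis using N_sym[OF mem(3)] N_sym[OF c(1)] by blast
qed

text \<open>\<open>square\<close> at \<open>p\<close> closes a 6-cycle, and \<open>square\<close> at
  \<open>b\<close>, \<open>b2\<close> and \<open>q\<close> shows that no edge leaves it. This is the
  case of \<open>Gamma_a\<close>.\<close>

lemma hexagon:
  assumes "card (N p) = 2" "\<And>b. b \<in> N p \<Longrightarrow> card (N b) = 2"
  obtains q s b b2 c where
    "N p = {b2, b}" "N q = {b, c}" "N s = {c, b2}" "N b = {p, q}" "N c = {q, s}" "N b2 = {s, p}"
    "distinct [p, q, s]" "distinct [b, c, b2]"
proof -
  obtain b b2 where p: "N p = {b, b2}" "b \<noteq> b2" using assms by (auto simp: card_2_iff)
  have mem: "p \<in> N b" "p \<in> N b2" using N_symD[OF p(1)] by auto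
  have 2: "card (N b) = 2" "card (N b2) = 2" using assms p by auto
  obtain q where q: "N b = {p, q}" "q \<noteq> p" using obtain_2[OF 2(1) mem(1)] .
  obtain s where s: "N b2 = {p, s}" "s \<noteq> p" using obtain_2[OF 2(2) mem(2)] .
  have qs: "q \<in> N b" "s \<in> N b2" using q s by auto
  obtain c where c: "q \<in> N c" "s \<in> N c" using square_dual[OF p qs(1) q(2) qs(2) s(2)] .
  have Nq: "N q = {b, c}" using hexagon_end[OF p q(1) q(2)[symmetric] s(1) s(2)[symmetric] c] .
  have Ns: "N s = {b2, c}"
    using hexagon_end[OF _ p(2)[symmetric] s(1) s(2)[symmetric] q(1) q(2)[symmetric] c(2,1)] p(1) by blast
  have "q \<noteq> s" using linear_dual mem p(2) q(2) qs by metis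
  have "b \<noteq> c" using linear_dual mem p(2) q(2) c s(2) qs by metis
  have "b2 \<noteq> c" using linear_dual mem p(2) q(2) c s(2) qs by metis
  have "t = q \<or> t = s" if t: "t \<in> N c" for t
  proof (rule ccontr)
    assume ne: "\<not> (t = q \<or> t = s)"
    then obtain y where y: "p \<in> N y" "t \<in> N y"
      using square_dual[OF Nq \<open>b \<noteq> c\<close> mem(1) q(2)[symmetric] t] by blast
    then have "y = b \<or> y = b2" using N_sym[OF y(1)] p by auto
    then show False
      using linear_dual[of t b q c] linear_dual[of t b2 s c] y t ne qs c \<open>b \<noteq> c\<close> \<open>b2 \<noteq> c\<close> by metis
  qed
  then have "N c = {q, s}" using c by blast
  then show ?thesis
    using that[of b2 b q c s] p q s Nq Ns \<open>q \<noteq> s\<close> \<open>b \<noteq> c\<close> \<open>b2 \<noteq> c\<close> by (auto simp: insert_commute)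
qed

section \<open>The theta graph around a vertex of degree 2 and its extensions\<close>

lemma short_pair:
  assumes "q \<in> N c" "s \<in> N c" "card (N q) = 3" "q \<noteq> s" "card (N c) = 2"
  shows "N c = {q, s}" "card (N s) = 2"
proof -
  show "N c = {q, s}" using card_2I[OF assms(5,1,2,4)] .
  \<comment> \<open>\<open>c\<close> must have a short neighbour, and \<open>q\<close> is
    long.\<close>
  then show "card (N s) = 2" using short_neighbour[OF assms(5)] assms(3) by auto
qed

text \<open>With \<open>hexagon\<close> excluded, one neighbour \<open>b\<close> of \<open>p\<close>
  is short and the other, \<open>b2\<close>, is long; \<open>square\<close> then links
  \<open>q\<close> to \<open>s1\<close> and \<open>s2\<close>. This is a theta graph with ends
  \<open>q\<close> and \<open>b2\<close> and three paths of length 3, as in \<open>Gamma_b\<close>.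
  The number of long vertices among \<open>s1\<close>, \<open>s2\<close> decides its extension: none
  leaves \<open>Gamma_b\<close>, one gives \<open>Gamma_c\<close>, two give
  \<open>Gamma_d\<close>.\<close>

lemma two_hexagons:
  assumes p2: "card (N p) = 2" and nhex: "\<And>v. card (N v) = 2 \<Longrightarrow> \<exists>b\<in>N v. card (N b) \<noteq> 2"
  obtains b b2 q s1 s2 c1 c2 where
    "N p = {b, b2}" "N b = {p, q}" "N b2 = {p, s1, s2}" "N q = {b, c1, c2}"
    "s1 \<in> N c1" "s2 \<in> N c2" "distinct [p, q, s1, s2]" "distinct [b, b2, c1, c2]"
proof -
  obtain b where b: "b \<in> N p" "card (N b) = 2" using short_neighbour[OF p2] by blast
  obtain b2 where b2: "N p = {b, b2}" "b2 \<noteq> b" using obtain_2[OF p2 b(1)] .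
  have b2c: "card (N b2) = 3" using nhex[OF p2] b(2) b2(1) long_or_short[OF N_symD[OF b2(1), of b2]] by auto
  have mem: "p \<in> N b" "p \<in> N b2" using N_symD[OF b2(1)] by auto
  obtain q where q: "N b = {p, q}" "q \<noteq> p" using obtain_2[OF b(2) mem(1)] .
  obtain s1 where s1: "s1 \<in> N b2" "s1 \<noteq> p" using obtain_other[OF mem(2)] .
  obtain s2 where s2: "N b2 = {p, s1, s2}" "s2 \<noteq> p" "s2 \<noteq> s1"
    using obtain_3[OF b2c mem(2) s1(1) s1(2)[symmetric]] .
  have qb: "q \<in> N b" "s2 \<in> N b2" using q s2 by auto
  obtain c1 where c1: "q \<in> N c1" "s1 \<in> N c1"
    using square_dual[OF b2(1) b2(2)[symmetric] qb(1) q(2) s1] .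
  obtain c2 where c2: "q \<in> N c2" "s2 \<in> N c2"
    using square_dual[OF b2(1) b2(2)[symmetric] qb(1) q(2) qb(2) s2(2)] .
  have "q \<notin> N b2" "s1 \<notin> N b" "s2 \<notin> N b"
    using linear_dual mem b2(2) q(2) s1 qb s2(2) by metis+
  then have d: "q \<noteq> s1" "q \<noteq> s2" "c1 \<noteq> b" "c1 \<noteq> b2" "c2 \<noteq> b" "c2 \<noteq> b2" using s1 qb c1 c2 by auto
  have "c1 \<noteq> c2" using linear_dual c1 c2 s1 qb s2(3) d by metis
  have "N q = {b, c1, c2}" using card_3I(2)[of b q c1 c2] d \<open>c1 \<noteq> c2\<close> qb c1 c2 N_sym by metis
  then show ?thesis
    using that[OF b2(1) q(1) s2(1) _ c1(2) c2(2)] d \<open>c1 \<noteq> c2\<close> q s1 s2 b2 by auto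
qed

text \<open>As \<open>u\<close> lies on no block of \<open>q\<close>, the formula for
  \<open>t\<close> reads 1 = <s, u> - 2 <p, u>. The bounds 0 and 1 force <s, u> = 1 and <p, u> = 0,
  so \<open>u\<close> lies on the remaining block of \<open>s\<close>.\<close>

lemma tail_block:
  assumes p: "N p = {b, b2}" "b \<noteq> b2" and b: "N b = {p, q}" "q \<noteq> p" and q: "N q = {b, c1, c2}" "card (N q) = 3"
    and s: "s \<in> N b2" "s \<noteq> p" "card (N s) = 3" and c1: "q \<in> N c1" "s \<in> N c1"
    and t: "t \<in> N c1" "t \<noteq> q" "t \<noteq> s"
    and e: "t \<in> N e" "e \<noteq> c1" and u: "u \<in> N e" "u \<noteq> t" "u \<notin> N c2"
  shows "gram s u = 1" "u \<notin> N b2" "u \<noteq> s" "u \<noteq> q" "u \<notin> N c1" "gram q u = 0"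
proof -
  have mem: "q \<in> N b" "p \<in> N b" "p \<in> N b2" using b N_symD[OF p(1)] by auto
  note f = p mem(1) b(2) q(2) s c1 t
  have tu: "gram t u = 1" using gram_1_dual e u by metis
  have "u \<noteq> p" using fourth_point_zero[OF f] tu by auto
  show c: "u \<notin> N c1" using linear_dual e t u by metis
  then show "u \<noteq> s" "u \<noteq> q" using c1 by auto
  then show 0: "gram q u = 0"
    using gram_0I[of q u] q(1) u(3) c b(1) \<open>u \<noteq> p\<close> by auto
  have 1: "gram t u = gram q u + gram s u - 2 * gram p u" using fourth_point_gram[OF f] .
  have 2: "0 \<le> gram p u" "gram s u \<le> 1" using gram_bounds[of s u] gram_bounds[of p u] \<open>u \<noteq> s\<close> \<open>u \<noteq> p\<close> by auto
  then show "gram s u = 1" using 0 1 tu by linarith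
  then have "gram p u = 0" using 0 1 2 tu by linarith
  then show "u \<notin> N b2" using gram_0_dual mem \<open>u \<noteq> p\<close> by metis
qed

text \<open>By \<open>tail_block\<close>, with \<open>c1\<close> and \<open>c2\<close> exchanged,
  the further vertices on the two other blocks of \<open>t\<close> all lie on the third block
  \<open>d\<close> of \<open>s2\<close>. It has room for only two of them, so the graph closes
  up.\<close>

lemma one_tail:
  assumes p: "N p = {b, b2}" and b: "N b = {p, q}" and b2: "N b2 = {p, s1, s2}"
    and q: "N q = {b, c1, c2}" and sc: "s1 \<in> N c1" "s2 \<in> N c2"
    and dis: "distinct [p, q, s1, s2]" "distinct [b, b2, c1, c2]"
    and s1: "card (N s1) = 2" and s2: "card (N s2) = 3"
  obtains t u1 u2 d e1 e2 where "N s1 = {b2, c1}" "N c1 = {q, s1}" "N s2 = {b2, c2, d}" "N c2 = {q, s2, t}"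
    "N t = {c2, e1, e2}" "N d = {s2, u1, u2}" "N e1 = {t, u1}" "N e2 = {t, u2}"
    "N u1 = {d, e1}" "N u2 = {d, e2}"
    "distinct [p, q, s1, s2, t, u1, u2]"
proof -
  have mem: "q \<in> N b" "q \<in> N c1" "q \<in> N c2" "s1 \<in> N b2" "s2 \<in> N b2" "p \<in> N b" "p \<in> N b2"
    using N_symD[OF q] N_symD[OF p] b2 sc by auto
  have d: "p \<noteq> q" "p \<noteq> s1" "p \<noteq> s2" "q \<noteq> s1" "q \<noteq> s2" "s1 \<noteq> s2"
     "b \<noteq> b2" "b \<noteq> c1" "b \<noteq> c2" "b2 \<noteq> c1" "b2 \<noteq> c2" "c1 \<noteq> c2" using dis by auto
  have q3: "card (N q) = 3" and b23: "card (N b2) = 3" using q b2 d by simp_all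
  have Ns1: "N s1 = {b2, c1}" using card_2I[OF s1 N_sym[OF mem(4)] N_sym[OF sc(1)] d(10)] .
  have "card (N c1) = 2" using short_neighbour[OF s1] Ns1 b23 by auto
  then have Nc1: "N c1 = {q, s1}" using short_pair(1)[of q c1 s1] mem sc q3 d by blast
  have "card (N c2) \<noteq> 2" using short_pair(2)[of q c2 s2] mem sc q3 d s2 by auto
  then have "card (N c2) = 3" using long_or_short[of q c2] mem by blast
  then obtain t where t: "N c2 = {q, s2, t}" "t \<noteq> q" "t \<noteq> s2"
    using obtain_3[of c2 q s2] mem sc d by metis
  have tc: "t \<in> N c2" using t by blast
  have f: "N p = {b, b2}" "b \<noteq> b2" "q \<in> N b" "q \<noteq> p" "card (N q) = 3" "s2 \<in> N b2" "s2 \<noteq> p" "card (N s2) = 3"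
     "q \<in> N c2" "s2 \<in> N c2" "t \<in> N c2" "t \<noteq> q" "t \<noteq> s2"
    using p d mem q3 s2 sc tc t by auto
  have t3: "card (N t) = 3" using fourth_point_degree[OF f] .
  obtain d' where d': "N s2 = {b2, c2, d'}" "d' \<noteq> b2" "d' \<noteq> c2"
    using obtain_3[OF s2, of b2 c2] mem sc d N_sym by metis
  obtain e1 where e1: "e1 \<in> N t" "e1 \<noteq> c2" using obtain_other[of c2 t] tc N_sym by metis
  obtain e2 where e2: "N t = {c2, e1, e2}" "e2 \<noteq> c2" "e2 \<noteq> e1"
    using obtain_3[OF t3, of c2 e1] tc e1 N_sym by metis
  have te: "t \<in> N e1" "t \<in> N e2" "s2 \<in> N d'" using N_symD[OF e2(1)] N_symD[OF d'(1)] by auto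
  have gs1: "gram t s1 = 0"
    using fourth_point_gram[OF f, of s1] gram_1_dual[of q c1 s1] gram_1_dual[of s2 b2 s1] gram_1_dual[of p b2 s1] mem sc d
    by auto
  have gp: "gram t p = 0" using fourth_point_zero[OF f] .
  have in_d: "u \<in> N d' \<and> u \<noteq> s2 \<and> u \<noteq> q \<and> u \<noteq> s1 \<and> u \<noteq> p"
    if u: "u \<in> N e" "u \<noteq> t" "t \<in> N e" "e \<noteq> c2" for e u
  proof -
    have "gram t u = 1" using gram_1_dual u by metis
    then have "u \<noteq> s1" "u \<noteq> p" using gs1 gp by auto
    have "u \<notin> N c2" using linear_dual u tc by metis
    then have "u \<noteq> q" using mem by auto
    then have nc1: "u \<notin> N c1" using Nc1 \<open>u \<noteq> s1\<close> by blast
    have q': "N q = {b, c2, c1}" using q by blast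
    have su: "gram s2 u = 1" "u \<notin> N b2" "u \<noteq> s2"
      using tail_block[OF f(1,2) b f(4) q' f(5-13) u(3,4,1,2) nc1] by blast+
    then have "u \<in> N d'" using gram_cases[of s2 u] d' \<open>u \<notin> N c2\<close> by auto
    then show ?thesis using su \<open>u \<noteq> q\<close> \<open>u \<noteq> s1\<close> \<open>u \<noteq> p\<close> by blast
  qed
  obtain u1 where u1: "u1 \<in> N e1" "u1 \<noteq> t" using obtain_other[OF te(1)] .
  obtain u2 where u2: "u2 \<in> N e2" "u2 \<noteq> t" using obtain_other[OF te(2)] .
  have i1: "u1 \<in> N d'" "u1 \<noteq> s2" "u1 \<noteq> q" "u1 \<noteq> s1" "u1 \<noteq> p" using in_d[OF u1 te(1) e1(2)] by blast+
  have i2: "u2 \<in> N d'" "u2 \<noteq> s2" "u2 \<noteq> q" "u2 \<noteq> s1" "u2 \<noteq> p" using in_d[OF u2 te(2) e2(2)] by blast+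
  have u12: "u1 \<noteq> u2" using linear_dual[of u1 e1 t e2] u1 u2 te e2(3) by metis
  have Nd: "N d' = {s2, u1, u2}" using card_3I(2)[of s2 d' u1 u2] te i1 i2 u12 by metis
  have "u2 \<notin> N e1" "u1 \<notin> N e2"
    using linear_dual[of u2 e1 t e2] linear_dual[of u1 e1 t e2] u1 u2 te e2(3) by metis+
  then have Ne: "N e1 = {t, u1}" "N e2 = {t, u2}"
    using in_d[OF _ _ te(1) e1(2)] in_d[OF _ _ te(2) e2(2)] te u1 u2 Nd by blast+
  have "t \<notin> N d'" using linear_dual[of t c2 s2 d'] tc sc te t d' by metis
  then have de: "d' \<noteq> e1" "d' \<noteq> e2" using te by auto
  have c: "card (N u1) = 2" "card (N u2) = 2"
    using short_pair(2)[OF te(1) u1(1) t3 u1(2)[symmetric]] short_pair(2)[OF te(2) u2(1) t3 u2(2)[symmetric]] Ne u1(2) u2(2)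
    by auto
  have Nu1: "N u1 = {d', e1}" using card_2I[OF c(1) N_sym[OF i1(1)] N_sym[OF u1(1)] de(1)] .
  have Nu2: "N u2 = {d', e2}" using card_2I[OF c(2) N_sym[OF i2(1)] N_sym[OF u2(1)] de(2)] .
  have "t \<noteq> p" using fourth_point_neq[OF f] .
  have "t \<noteq> s1" using gram_0_dual linear_dual tc sc mem d by metis
  have "distinct [p, q, s1, s2, t, u1, u2]"
    using d(1-6) t(2,3) u1(2) u2(2) i1(2-5) i2(2-5) u12 \<open>t \<noteq> p\<close> \<open>t \<noteq> s1\<close> by auto
  then show ?thesis
    using that[OF Ns1 Nc1 d'(1) t(1) e2(1) Nd Ne Nu1 Nu2] by blast
qed

lemma short_tail:
  assumes "card (N s) = 2" "card (N b) = 3" "card (N q) = 3" "s \<in> N b" "s \<in> N c" "q \<in> N c" "q \<noteq> s" "b \<noteq> c"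
  shows "N s = {b, c}" "N c = {q, s}"
proof -
  show s: "N s = {b, c}" using card_2I[OF assms(1) N_sym[OF assms(4)] N_sym[OF assms(5)] assms(8)] .
  then have "card (N c) = 2" using short_neighbour[OF assms(1)] assms(2) by auto
  then show "N c = {q, s}" using short_pair(1) assms by blast
qed

text \<open>One of two mirror images, to be used with the indices 1 and 2 exchanged as well. Besides
  \<open>c1\<close>, \<open>t1\<close> has the block \<open>f\<close>, shared with
  \<open>t2\<close>, and a block \<open>e\<close>. \<open>tail_block\<close> puts their further
  vertices on the third block \<open>d\<close> of \<open>s1\<close>, except for \<open>t2\<close>,
  which lies on the block \<open>c2\<close> of \<open>q\<close>.\<close>

lemma half_of_two_tails:
  assumes p: "N p = {b, b2}" "b \<noteq> b2" and b: "N b = {p, q}" "q \<noteq> p" and q: "N q = {b, c1, c2}" "card (N q) = 3"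
    and b2: "N b2 = {p, s1, s2}" and s1: "s1 \<in> N b2" "s1 \<noteq> p" "card (N s1) = 3" and c1: "N c1 = {q, s1, t1}"
    and c2: "N c2 = {q, s2, t2}" and t1: "t1 \<noteq> q" "t1 \<noteq> s1"
    and f: "t1 \<in> N f" "t2 \<in> N f" "f \<noteq> c1" "t1 \<noteq> t2"
    and g: "gram t1 s2 = 0" "gram t2 s1 = 0" "gram t2 p = 0" and d0: "distinct [p, q, s1, s2]" "t2 \<noteq> q" "t2 \<noteq> s2"
    and t3: "card (N t1) = 3"
    and nhex: "\<And>v. card (N v) = 2 \<Longrightarrow> \<exists>b\<in>N v. card (N b) \<noteq> 2"
  obtains d e u w where "N s1 = {b2, c1, d}" "N t1 = {c1, f, e}" "N e = {t1, u}" "N u = {d, e}"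
    "N d = {s1, u, w}" "N f = {t1, t2, w}" "distinct [p, q, s1, s2, t1, t2, u, w]"
proof -
  have mem: "q \<in> N b" "p \<in> N b2" "p \<in> N b" "q \<in> N c1" "s1 \<in> N c1" "t1 \<in> N c1" "q \<in> N c2" "s2 \<in> N c2" "t2 \<in> N c2"
    "s2 \<in> N b2"
    using b N_symD[OF p(1)] c1 c2 b2 by auto
  note fp = p mem(1) b(2) q(2) s1 mem(4-6) t1
  have gp: "gram t1 p = 0" "t1 \<noteq> p" using fourth_point_zero[OF fp] fourth_point_neq[OF fp] by auto
  have ts2: "t1 \<noteq> s2" using g t3 by (auto simp: gram_self)
  have "b2 \<noteq> c1" using b2 c1 t1 gp ts2 d0 by auto
  then obtain d where d: "N s1 = {b2, c1, d}" "d \<noteq> b2" "d \<noteq> c1"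
    using obtain_3[OF s1(3) N_sym[OF s1(1)] N_sym[OF mem(5)]] by metis
  obtain e where e: "N t1 = {c1, f, e}" "e \<noteq> c1" "e \<noteq> f"
    using obtain_3[OF t3 N_sym[OF mem(6)] N_sym[OF f(1)] f(3)[symmetric]] by metis
  have te: "t1 \<in> N e" "s1 \<in> N d" using N_symD[OF e(1)] N_symD[OF d(1)] by auto
  have in_d: "x \<in> N d \<and> x \<notin> {p, q, s1, s2}"
    if x: "x \<in> N h" "x \<noteq> t1" "x \<noteq> t2" "t1 \<in> N h" "h \<noteq> c1" for h x
  proof -
    have 1: "gram t1 x = 1" using gram_1_dual x by metis
    then have ne: "x \<noteq> s2" "x \<noteq> p" using g gp by auto
    have "x \<noteq> q" using linear_dual[of q c1 t1 h] mem t1 x by metis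
    then have "x \<notin> N c2" using c2 x ne by auto
    then have su: "gram s1 x = 1" "x \<notin> N b2" "x \<noteq> s1" "x \<notin> N c1"
      using tail_block[OF p b q s1 mem(4,5,6) t1 x(4,5,1,2)] by blast+
    then have "x \<in> N d" using gram_cases[of s1 x] d by auto
    then show ?thesis using su(3) ne \<open>x \<noteq> q\<close> by blast
  qed
  obtain u where u: "u \<in> N e" "u \<noteq> t1" using obtain_other[OF te(1)] .
  have nt2: "t2 \<notin> N e" using linear_dual[of t1 f t2 e] f e(3) te by metis
  then have ut2: "u \<noteq> t2" using u by auto
  have ud: "u \<in> N d" "u \<notin> {p, q, s1, s2}" using in_d[OF u ut2 te(1) e(2)] by auto
  have "t1 \<notin> N d" using linear_dual[of t1 c1 s1 d] mem te t1 d(3) by metis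
  then have "d \<noteq> e" using te by auto
  \<comment> \<open>All vertices of \<open>e\<close> but \<open>t1\<close> lie on \<open>d\<close>,
    and \<open>d\<close> and \<open>e\<close> share at most one vertex.\<close>
  have "x = t1 \<or> x = u" if "x \<in> N e" for x
  proof (rule ccontr)
    assume "\<not> (x = t1 \<or> x = u)"
    moreover from this have "x \<in> N d" using in_d[OF that _ _ te(1) e(2)] nt2 that by auto
    ultimately show False using linear_dual[of x e u d] that u ud \<open>d \<noteq> e\<close> by metis
  qed
  then have Ne: "N e = {t1, u}" using te u by blast
  then have e2: "card (N e) = 2" using u by simp
  have u2: "card (N u) = 2" using short_pair(2)[OF te(1) u(1) t3 u(2)[symmetric] e2] .
  have Nu: "N u = {d, e}" using card_2I[OF u2 N_sym[OF ud(1)] N_sym[OF u(1)] \<open>d \<noteq> e\<close>] .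
  \<comment> \<open>\<open>u\<close> already has the short neighbour \<open>e\<close>, so its other
    neighbour must be long.\<close>
  then have "card (N d) \<noteq> 2" using nhex[OF u2] e2 by auto
  then have d3: "card (N d) = 3" using long_or_short[OF te(2)] by blast
  obtain w where w: "N d = {s1, u, w}" "w \<noteq> s1" "w \<noteq> u"
    using obtain_3[OF d3 te(2) ud(1)] ud(2) by blast
  have wd: "w \<in> N d" using w by auto
  have w1: "w \<noteq> t1" using wd \<open>t1 \<notin> N d\<close> by auto
  have w2: "w \<noteq> t2" using gram_0_dual[OF g(2) _ te(2)] wd w(2) by metis
  have wb2: "w \<notin> N b2" using linear_dual[of w b2 s1 d] s1 te wd w(2) d(2) by metis
  have wc1: "w \<notin> N c1" using linear_dual[of w c1 s1 d] mem te wd w(2) d(3) by metis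
  have ws2: "w \<noteq> p" "w \<noteq> s2" "w \<noteq> q" using wb2 wc1 mem by auto
  have "gram q w = 0" using gram_0I[of q w] q(1) wc1 b(1) c2 ws2 w2 by auto
  moreover have "gram p w = 0" using gram_0I[of p w] p(1) b(1) wb2 ws2 by auto
  moreover have "gram s1 w = 1" using gram_1_dual[OF te(2) wd] w(2) by metis
  \<comment> \<open>The formula gives 0 + 1 - 0. As \<open>c1\<close> and \<open>e\<close> miss
    \<open>w\<close>, the block shared with \<open>t1\<close> is \<open>f\<close>.\<close>
  ultimately have "gram t1 w = 1" using fourth_point_gram[OF fp, of w] by simp
  then have wf: "w \<in> N f" using gram_cases[of t1 w] w1 e(1) wc1 Ne w(3) by auto
  have Nf: "N f = {t1, t2, w}" using card_3I(2)[OF f(1,2) wf f(4) w1[symmetric] w2[symmetric]] .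
  have t2p: "t2 \<noteq> p" "t2 \<noteq> s1"
    using linear_dual[of p b2 s2 c2] mem d0 gram_0_dual[OF g(2)] gram_0_dual[OF g(3)] s1 c2 b2 N_symD[OF d(1)] by auto
  have "distinct [p, q, s1, s2, t1, t2, u, w]"
    using d0 gp(2) t1 ts2 t2p f(4) ud(2) u(2) ut2 ws2 w(2,3) w1 w2 by auto
  then show ?thesis using that[OF d(1) e(1) Ne Nu w(1) Nf] by blast
qed

lemma two_tails:
  assumes p: "N p = {b, b2}" and b: "N b = {p, q}" and b2: "N b2 = {p, s1, s2}"
    and q: "N q = {b, c1, c2}" and sc: "s1 \<in> N c1" "s2 \<in> N c2"
    and dis: "distinct [p, q, s1, s2]" "distinct [b, b2, c1, c2]"
    and s1: "card (N s1) = 3" and s2: "card (N s2) = 3"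
    and nhex: "\<And>v. card (N v) = 2 \<Longrightarrow> \<exists>b\<in>N v. card (N b) \<noteq> 2"
  obtains t1 t2 u1 u2 w d1 d2 e1 e2 f where
    "N c1 = {q, s1, t1}" "N c2 = {q, s2, t2}" "N f = {t1, t2, w}" "N d1 = {s1, u1, w}" "N d2 = {s2, u2, w}"
    "N e1 = {t1, u1}" "N e2 = {t2, u2}"
    "N s1 = {b2, c1, d1}" "N s2 = {b2, c2, d2}" "N t1 = {c1, f, e1}" "N t2 = {c2, f, e2}"
    "N u1 = {d1, e1}" "N u2 = {d2, e2}" "N w = {d1, d2, f}"
    "distinct [p, q, s1, s2, t1, t2, u1, u2, w]"
proof -
  have mem: "q \<in> N b" "q \<in> N c1" "q \<in> N c2" "s1 \<in> N b2" "s2 \<in> N b2" "p \<in> N b" "p \<in> N b2"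
    using N_symD[OF q] N_symD[OF p] b2 by auto
  have d: "p \<noteq> q" "p \<noteq> s1" "p \<noteq> s2" "q \<noteq> s1" "q \<noteq> s2" "s1 \<noteq> s2"
     "b \<noteq> b2" "b \<noteq> c1" "b \<noteq> c2" "b2 \<noteq> c1" "b2 \<noteq> c2" "c1 \<noteq> c2" using dis by auto
  have q3: "card (N q) = 3" and b23: "card (N b2) = 3" using q b2 d by simp_all
  have "card (N c1) \<noteq> 2" "card (N c2) \<noteq> 2"
    using short_pair(2)[OF mem(2) sc(1) q3 d(4)] short_pair(2)[OF mem(3) sc(2) q3 d(5)] s1 s2 by auto
  then have "card (N c1) = 3" "card (N c2) = 3" using long_or_short mem by blast+
  then obtain t1 t2 where t1: "N c1 = {q, s1, t1}" "t1 \<noteq> q" "t1 \<noteq> s1"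
    and t2: "N c2 = {q, s2, t2}" "t2 \<noteq> q" "t2 \<noteq> s2"
    using obtain_3[OF _ mem(2) sc(1) d(4)] obtain_3[OF _ mem(3) sc(2) d(5)] by metis
  have tc: "t1 \<in> N c1" "t2 \<in> N c2" using t1 t2 by auto
  note f1 = p d(7) mem(1) d(1)[symmetric] q3 mem(4) d(2)[symmetric] s1 mem(2) sc(1) tc(1) t1(2,3)
  note f2 = p d(7) mem(1) d(1)[symmetric] q3 mem(5) d(3)[symmetric] s2 mem(3) sc(2) tc(2) t2(2,3)
  have g: "gram q s1 = 1" "gram q s2 = 1" "gram s1 s2 = 1" "gram s2 s1 = 1" "gram p s1 = 1" "gram p s2 = 1" "gram q t2 = 1"
    using gram_1_dual mem sc d tc t2(2) by metis+
  have g1: "gram t1 s2 = 0" and g2: "gram t2 s1 = 0"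
    using fourth_point_gram[OF f1, of s2] fourth_point_gram[OF f2, of s1] g by auto
  have gp: "gram t1 p = 0" "gram t2 p = 0" using fourth_point_zero[OF f1] fourth_point_zero[OF f2] .
  have t3: "card (N t1) = 3" "card (N t2) = 3" using fourth_point_degree[OF f1] fourth_point_degree[OF f2] .
  \<comment> \<open>The formula for \<open>t1\<close> gives 1 + 0 - 0: the two tails meet in a block
    \<open>f\<close>.\<close>
  have t12: "gram t1 t2 = 1"
    using fourth_point_gram[OF f1, of t2] g g2 gp gram_commute[of s1 t2] gram_commute[of p t2] by simp
  then have ne: "t1 \<noteq> t2" using t3 by (auto simp: gram_self)
  obtain f where f: "t1 \<in> N f" "t2 \<in> N f" using gram_pos[OF t12 ne] N_sym by blast
  have "f \<noteq> c1" "f \<noteq> c2" using linear_dual f tc mem t1(2) t2(2) d(12) by metis+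
  obtain d1 e1 u1 w where 1: "N s1 = {b2, c1, d1}" "N t1 = {c1, f, e1}" "N e1 = {t1, u1}" "N u1 = {d1, e1}"
    "N d1 = {s1, u1, w}" "N f = {t1, t2, w}" "distinct [p, q, s1, s2, t1, t2, u1, w]"
    using half_of_two_tails[OF p d(7) b d(1)[symmetric] q q3 b2 mem(4) d(2)[symmetric] s1 t1(1) t2(1) t1(2,3)
        f \<open>f \<noteq> c1\<close> ne g1 g2 gp(2) dis(1) t2(2,3) t3(1) nhex] .
  have q': "N q = {b, c2, c1}" and b2': "N b2 = {p, s2, s1}" and dis': "distinct [p, q, s2, s1]"
    using q b2 d by auto
  obtain d2 e2 u2 w' where 2: "N s2 = {b2, c2, d2}" "N t2 = {c2, f, e2}" "N e2 = {t2, u2}" "N u2 = {d2, e2}"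
    "N d2 = {s2, u2, w'}" "N f = {t2, t1, w'}" "distinct [p, q, s2, s1, t2, t1, u2, w']"
    using half_of_two_tails[OF p d(7) b d(1)[symmetric] q' q3 b2' mem(5) d(3)[symmetric] s2 t2(1) t1(1) t2(2,3)
        f(2,1) \<open>f \<noteq> c2\<close> ne[symmetric] g2 g1 gp(1) dis' t1(2,3) t3(2) nhex] .
  have "w \<in> N f" using 1(6) by blast
  moreover have "w \<noteq> t1" "w \<noteq> t2" using 1(7) by auto
  \<comment> \<open>\<open>f\<close> has one vertex besides \<open>t1\<close> and \<open>t2\<close>,
    so both halves find the same one.\<close>
  ultimately have "w' = w" unfolding 2(6) by blast
  note 2 = 2[unfolded this]
  have "t2 \<in> N e2" using 2(3) by blast
  moreover have "t2 \<notin> N e1" "t2 \<notin> N d1" unfolding 1(3,5) using 1(7) by auto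
  ultimately have "e1 \<noteq> e2" "d1 \<noteq> e2" by auto
  moreover have "e2 \<in> N u2" unfolding 2(4) by blast
  ultimately have "u1 \<noteq> u2" using 1(4) by auto
  then have dist: "distinct [p, q, s1, s2, t1, t2, u1, u2, w]" using 1(7) 2(7) by auto
  have wm: "d1 \<in> N w" "d2 \<in> N w" "f \<in> N w" using N_symD[OF 1(5)] N_symD[OF 2(5)] N_symD[OF 1(6)] by auto
  have "t1 \<notin> N d1" "s2 \<notin> N d1" "t2 \<notin> N d2" "s2 \<in> N d2" unfolding 1(5) 2(5) using dist by auto
  then have "d1 \<noteq> d2" "d1 \<noteq> f" "d2 \<noteq> f" using f by auto
  then have "N w = {d1, d2, f}" using card_3I(2)[OF wm] by blast
  then show ?thesis using that[OF t1(1) t2(1) 1(6,5) 2(5) 1(3) 2(3) 1(1) 2(1) 1(2) 2(2) 1(4) 2(4) _ dist] by blast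
qed

end

section \<open>Isomorphisms\<close>

lemma converse_insert: "(insert (a, b) R)\<inverse> = insert (b, a) (R\<inverse>)"
  by auto

text \<open>The map runs from the concrete target \<open>K\<close> into \<open>H\<close>, where it
  can be given by listing images; the isomorphism is its inverse \<open>g\<close>.\<close>

lemma digraph_iso_with_projI:
  assumes "pair_wf_digraph H" and inj: "inj_on f (pverts K)"
    and verts: "pverts H = f ` pverts K" and arcs: "parcs H = map_prod f f ` parcs K"
    and wf: "parcs K \<subseteq> pverts K \<times> pverts K"
  shows "digraph_iso (with_proj H) (with_proj K)"
proof -
  define g where "g = the_inv_into (pverts K) f"
  define h where "h = \<lparr>iso_verts = g, iso_arcs = map_prod g g, iso_head = snd, iso_tail = fst\<rparr>"
  interpret pair_wf_digraph H by fact
  have gf: "g (f x) = x" if "x \<in> pverts K" for x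
    using that inj by (simp add: g_def the_inv_into_f_f)
  have g_arcs: "map_prod g g (map_prod f f e) = e" if "e \<in> parcs K" for e
    using that wf by (cases e) (auto simp: gf)
  have "inj_on g (pverts H)" "inj_on (map_prod g g) (parcs H)"
    unfolding verts arcs by (auto simp: inj_on_def gf g_arcs simp del: map_prod_simp)
  then have "pre_digraph.digraph_isomorphism (with_proj H) h"
    by (auto simp: pre_digraph.digraph_isomorphism_def h_def wf_digraph_wp_iff intro: assms)
  moreover have "with_proj K = app_iso h (with_proj H)"
  proof -
    have "g ` pverts H = pverts K" "map_prod g g ` parcs H = parcs K"
      unfolding verts arcs image_image by (simp_all add: gf g_arcs cong: image_cong)
    then show ?thesis by (simp add: with_proj_def app_iso_def h_def)
  qed
  ultimately show ?thesis unfolding digraph_iso_def by blast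
qed

context expanding_subcubic
begin

definition graph_of :: "'a pair_pre_digraph" where
  "graph_of = \<lparr>pverts = V, parcs = {(u, v). v \<in> N u}\<rparr>"

lemma pair_wf_graph_of: "pair_wf_digraph graph_of"
  by unfold_locales (auto simp: graph_of_def N_V)

lemma parcs_graph_of: "parcs graph_of = (\<Union>u\<in>V. Pair u ` N u)"
  by (force simp: graph_of_def dest: N_V(2))

lemma pverts_graph_of: "pverts graph_of = V"
  by (simp add: graph_of_def)

lemma iso_list:
  assumes "distinct xs" "V = set xs" "pverts K = {0..<length xs}" "parcs K \<subseteq> pverts K \<times> pverts K"
    and "(\<Union>u\<in>set xs. Pair u ` N u) = map_prod ((!) xs) ((!) xs) ` parcs K"
  shows "digraph_iso (with_proj graph_of) (with_proj K)"
proof (rule digraph_iso_with_projI[OF pair_wf_graph_of, where f = "(!) xs"])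
  show "inj_on ((!) xs) (pverts K)" using assms by (auto intro: inj_on_nth)
  have "V = (!) xs ` {0..<length xs}" using assms(2) by (auto simp: set_conv_nth)
  then show "pverts graph_of = (!) xs ` pverts K"
    unfolding pverts_graph_of assms(3) .
  show "parcs graph_of = map_prod ((!) xs) ((!) xs) ` parcs K"
    unfolding parcs_graph_of using assms by simp
qed (use assms in simp)

lemma block_eqI: "c \<in> V \<Longrightarrow> N c = N c' \<Longrightarrow> c = c'"
proof -
  assume "c \<in> V" and eq: "N c = N c'"
  then obtain a b where "a \<in> N c" "b \<in> N c" "a \<noteq> b"
    using degree[of c] by (auto simp: card_2_iff card_3_iff)
  then show "c = c'" using linear_dual[of a c b c'] eq by auto
qed

text \<open>A block is determined by its vertices (\<open>block_eqI\<close>), so a member B of the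
  family can be sent to the block whose neighbourhood is the image of B; this is
  \<open>h\<close>.\<close>

lemma iso_incidence_graph:
  assumes inj: "inj_on f P" and V: "V = f ` P \<union> C" and disj: "f ` P \<inter> C = {}"
    and blocks: "N ` C = (`) f ` \<B>" and sub: "\<B> \<subseteq> Pow P" and pts: "\<And>p. p \<in> P \<Longrightarrow> N (f p) \<subseteq> C"
  shows "digraph_iso (with_proj graph_of) (with_proj (incidence_graph P \<B>))"
proof -
  have injN: "inj_on N C" using block_eqI V by (auto simp: inj_on_def)
  define h where "h B = the_inv_into C N (f ` B)" for B
  have h: "h B \<in> C" "N (h B) = f ` B" if "B \<in> \<B>" for B
    unfolding h_def using that blocks injN by (auto intro!: the_inv_into_into f_the_inv_into_f)
  have inj_img: "B = B'" if "B \<in> \<B>" "B' \<in> \<B>" "f ` B = f ` B'" for B B'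
    using that sub inj by (meson PowD inj_on_image_eq_iff subsetD)
  have hC: "\<exists>B\<in>\<B>. c = h B" if "c \<in> C" for c
  proof -
    have "N c \<in> (`) f ` \<B>" using that blocks by auto
    then obtain B where B: "B \<in> \<B>" "N c = f ` B" by auto
    then have "c = h B" using h[OF B(1)] inj_onD[OF injN] that by metis
    then show ?thesis using B by blast
  qed
  define F where "F = case_sum f h"
  have F: "F (Inl p) = f p" "F (Inr B) = h B" for p B by (simp_all add: F_def)
  let ?K = "incidence_graph P \<B>"
  let ?E = "{(Inl p, Inr B) |p B. p \<in> P \<and> B \<in> \<B> \<and> p \<in> B}"
  have K: "pverts ?K = Inl ` P \<union> Inr ` \<B>" "parcs ?K = ?E \<union> ?E\<inverse>"
    by (simp_all add: incidence_graph_def graph_of_edges_def)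
  show ?thesis
  proof (rule digraph_iso_with_projI[OF pair_wf_graph_of, where f = F])
    show "inj_on F (pverts ?K)"
    proof (rule inj_onI)
      fix x y assume xy: "x \<in> pverts ?K" "y \<in> pverts ?K" "F x = F y"
      have mixed: "f p \<noteq> h B" if "p \<in> P" "B \<in> \<B>" for p B
        using that h(1)[of B] disj by (metis disjoint_iff imageI)
      have "B = B'" if "B \<in> \<B>" "B' \<in> \<B>" "h B = h B'" for B B'
        using that inj_img h(2) by metis
      then show "x = y"
        using xy(3) mixed mixed[symmetric] inj_onD[OF inj] xy(1,2) unfolding K
        by (cases x; cases y) (auto simp: F)
    qed
    show "pverts graph_of = F ` pverts ?K"
    proof -
      have "C = h ` \<B>" using hC h(1) by blast
      then show ?thesis unfolding pverts_graph_of K image_Un image_image F using V by simp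
    qed
    show "parcs ?K \<subseteq> pverts ?K \<times> pverts ?K" unfolding K by auto
    have E: "map_prod F F ` ?E = {(u, v). u \<in> f ` P \<and> v \<in> N u}"
    proof (intro equalityI subsetI)
      fix e assume "e \<in> map_prod F F ` ?E"
      then obtain p B where "e = (f p, h B)" "p \<in> P" "B \<in> \<B>" "p \<in> B" by (auto simp: F)
      moreover from this have "f p \<in> N (h B)" using h by simp
      ultimately show "e \<in> {(u, v). u \<in> f ` P \<and> v \<in> N u}" using N_sym by auto
    next
      fix e assume "e \<in> {(u, v). u \<in> f ` P \<and> v \<in> N u}"
      then obtain p v where e: "e = (f p, v)" "p \<in> P" "v \<in> N (f p)" by auto
      then obtain B where B: "B \<in> \<B>" "v = h B" using pts hC by blast
      then have "f p \<in> f ` B" using e h(2) N_sym by blast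
      then have "p \<in> B" using inj e(2) B(1) sub by (meson PowD inj_on_image_mem_iff subsetD)
      then have "(Inl p, Inr B) \<in> ?E" using e B by blast
      moreover have "e = map_prod F F (Inl p, Inr B)" using e B by (simp add: F)
      ultimately show "e \<in> map_prod F F ` ?E" by (rule rev_image_eqI)
    qed
    have conv: "map_prod F F ` (R\<inverse>) = (map_prod F F ` R)\<inverse>" for R by force
    have NC: "u \<in> f ` P \<or> v \<in> f ` P" if "v \<in> N u" for u v
    proof (cases "u \<in> f ` P")
      case False
      then have "u \<in> C" using N_V that V by blast
      then obtain B where "B \<in> \<B>" "N u = f ` B" using hC h(2) by metis
      then show ?thesis using that sub by blast
    qed simp
    show "parcs graph_of = map_prod F F ` parcs ?K"
      unfolding K image_Un conv E graph_of_def using NC N_sym by auto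
  qed
qed

text \<open>By connectedness, a local configuration closed under neighbours is already the whole
  graph.\<close>

lemma vertices_eq:
  assumes "v \<in> S" "v \<in> V" "\<And>x. x \<in> S \<Longrightarrow> N x \<noteq> {} \<and> N x \<subseteq> S"
  shows "V = S"
  using connected[of S] assms N_V by (metis ex_in_conv subsetI empty_iff)

section \<open>Recognising the four graphs\<close>

lemma iso_Gamma_a:
  assumes "N p = {b2, b}" "N q = {b, c}" "N s = {c, b2}" "N b = {p, q}" "N c = {q, s}" "N b2 = {s, p}"
    "distinct [p, q, s]" "distinct [b, c, b2]"
  shows "digraph_iso (with_proj graph_of) (with_proj Gamma_a)"
proof -
  have "p \<in> N b" "q \<in> N b" "q \<in> N c" "s \<in> N c" "s \<in> N b2" using assms by auto
  then have "side p \<noteq> side b" "side q \<noteq> side b" "side q \<noteq> side c" "side s \<noteq> side c" "side s \<noteq> side b2"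
    using N_side by blast+
  then have d: "distinct [p, b, q, c, s, b2]" using assms(7,8) by auto
  have V: "V = set [p, b, q, c, s, b2]"
    by (rule vertices_eq[of p], simp, rule N_V(1)[OF \<open>p \<in> N b\<close>]) (auto simp: assms(1-6))
  show ?thesis
  proof (rule iso_list[OF d V])
    show "(\<Union>u\<in>set [p, b, q, c, s, b2]. Pair u ` N u) =
        map_prod ((!) [p, b, q, c, s, b2]) ((!) [p, b, q, c, s, b2]) ` parcs Gamma_a"
      by (rule equalityI; simp add: Gamma_a_def graph_of_edges_def converse_insert assms(1-6))
  qed (auto simp: Gamma_a_def graph_of_edges_def)
qed

lemma iso_Gamma_b:
  assumes "N p = {b, b2}" "N b = {p, q}" "N b2 = {p, s1, s2}" "N q = {b, c1, c2}"
    "N s1 = {b2, c1}" "N s2 = {b2, c2}" "N c1 = {q, s1}" "N c2 = {q, s2}"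
    "distinct [p, q, s1, s2]" "distinct [b, b2, c1, c2]"
  shows "digraph_iso (with_proj graph_of) (with_proj Gamma_b)"
proof -
  have "p \<in> N b" "p \<in> N b2" "q \<in> N b" "s1 \<in> N b2" "s2 \<in> N b2" "q \<in> N c1" "q \<in> N c2" using assms by auto
  then have "side p \<noteq> side b" "side p \<noteq> side b2" "side q \<noteq> side b" "side s1 \<noteq> side b2" "side s2 \<noteq> side b2"
      "side q \<noteq> side c1" "side q \<noteq> side c2"
    using N_side by blast+
  \<comment> \<open>Positions are the labels of \<open>Gamma_b\<close>: the ends 0 and 1 are
    \<open>q\<close> and \<open>b2\<close>, followed by the inner vertices of the three
    paths.\<close>
  then have d: "distinct [q, b2, b, p, c1, s1, c2, s2]" using assms(9,10) by auto
  have V: "V = set [q, b2, b, p, c1, s1, c2, s2]"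
    by (rule vertices_eq[of p], simp, rule N_V(1)[OF \<open>p \<in> N b\<close>]) (auto simp: assms(1-8))
  show ?thesis
  proof (rule iso_list[OF d V])
    show "(\<Union>u\<in>set [q, b2, b, p, c1, s1, c2, s2]. Pair u ` N u) =
        map_prod ((!) [q, b2, b, p, c1, s1, c2, s2]) ((!) [q, b2, b, p, c1, s1, c2, s2]) ` parcs Gamma_b"
      by (rule equalityI; simp add: Gamma_b_def graph_of_edges_def converse_insert assms(1-8))
  qed (auto simp: Gamma_b_def graph_of_edges_def)
qed

lemma iso_Gamma_c:
  assumes N: "N p = {b, b2}" "N b = {p, q}" "N b2 = {p, s1, s2}" "N q = {b, c1, c2}"
    "N s1 = {b2, c1}" "N c1 = {q, s1}" "N s2 = {b2, c2, d}" "N c2 = {q, s2, t}"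
    "N t = {c2, e1, e2}" "N d = {s2, u1, u2}" "N e1 = {t, u1}" "N e2 = {t, u2}"
    "N u1 = {d, e1}" "N u2 = {d, e2}"
    and dist: "distinct [p, q, s1, s2, t, u1, u2]"
  shows "digraph_iso (with_proj graph_of) (with_proj Gamma_c)"
proof -
  \<comment> \<open>\<open>s2\<close> has to be \<open>pt_a\<close>, the one point on three blocks
    of size 3; \<open>pt_h\<close> and \<open>pt_i\<close> do not occur in
    \<open>Gamma_c\<close>.\<close>
  define f where "f = case_point s2 q t u1 p s1 u2 undefined undefined"
  have f: "f pt_a = s2" "f pt_b = q" "f pt_c = t" "f pt_d = u1" "f pt_e = p" "f pt_f = s1" "f pt_g = u2"
    by (simp_all add: f_def)
  let ?P = "{pt_a, pt_b, pt_c, pt_d, pt_e, pt_f, pt_g}"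
  let ?C = "{c2, d, b2, b, c1, e1, e2}"
  have fP: "f ` ?P = {s2, q, t, u1, p, s1, u2}" by (simp add: f)
  have "p \<in> N b" "q \<in> N b" "p \<in> N b2" "s1 \<in> N b2" "s2 \<in> N b2" "t \<in> N c2" "q \<in> N c2" "q \<in> N c1"
      "s2 \<in> N d" "u1 \<in> N d" "u2 \<in> N d" "u1 \<in> N e1" "u2 \<in> N e2" using N by auto
  then have side: "side p \<noteq> side b" "side q \<noteq> side b" "side p \<noteq> side b2" "side s1 \<noteq> side b2" "side s2 \<noteq> side b2"
      "side t \<noteq> side c2" "side q \<noteq> side c2" "side q \<noteq> side c1"
      "side s2 \<noteq> side d" "side u1 \<noteq> side d" "side u2 \<noteq> side d" "side u1 \<noteq> side e1" "side u2 \<noteq> side e2"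
    using N_side by blast+
  show ?thesis unfolding Gamma_c_def
  proof (rule iso_incidence_graph[where f = f and C = ?C])
    show "inj_on f ?P" using dist by (simp add: f) auto
    show "V = f ` ?P \<union> ?C"
      unfolding fP by (rule vertices_eq[of p], simp, rule N_V(1)[OF \<open>p \<in> N b\<close>]) (auto simp: N)
    have "\<forall>x\<in>f ` ?P. side x = side p" "\<forall>c\<in>?C. side c \<noteq> side p" unfolding fP using side by auto
    then show "f ` ?P \<inter> ?C = {}" by fastforce
    have "N c2 = f ` {pt_a, pt_b, pt_c}" "N d = f ` {pt_a, pt_d, pt_g}" "N b2 = f ` {pt_a, pt_e, pt_f}" "N b = f ` {pt_b, pt_e}" "N c1 = f ` {pt_b, pt_f}" "N e1 = f ` {pt_c, pt_d}" "N e2 = f ` {pt_c, pt_g}" by (simp_all add: N f insert_commute)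
    then show "N ` ?C = (`) f ` {{pt_a, pt_b, pt_c}, {pt_a, pt_d, pt_g}, {pt_a, pt_e, pt_f}, {pt_b, pt_e}, {pt_b, pt_f}, {pt_c, pt_d}, {pt_c, pt_g}}"
      by (simp only: image_insert image_empty)
    show "N (f x) \<subseteq> ?C" if "x \<in> ?P" for x using that by (elim insertE emptyE) (simp_all add: f N)
  qed simp
qed

lemma iso_Gamma_d:
  assumes N: "N p = {b, b2}" "N b = {p, q}" "N b2 = {p, s1, s2}" "N q = {b, c1, c2}"
    "N c1 = {q, s1, t1}" "N c2 = {q, s2, t2}" "N f' = {t1, t2, w}" "N d1 = {s1, u1, w}" "N d2 = {s2, u2, w}"
    "N e1 = {t1, u1}" "N e2 = {t2, u2}"
    "N s1 = {b2, c1, d1}" "N s2 = {b2, c2, d2}" "N t1 = {c1, f', e1}" "N t2 = {c2, f', e2}"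
    "N u1 = {d1, e1}" "N u2 = {d2, e2}" "N w = {d1, d2, f'}"
    and dist: "distinct [p, q, s1, s2, t1, t2, u1, u2, w]"
  shows "digraph_iso (with_proj graph_of) (with_proj Gamma_d)"
proof -
  \<comment> \<open>The points \<open>p\<close>, \<open>u1\<close>, \<open>u2\<close> of degree 2
    become \<open>pt_g\<close>, \<open>pt_h\<close>, \<open>pt_i\<close>.\<close>
  define f where "f = case_point q s2 s1 w t1 t2 p u1 u2"
  have f: "f pt_a = q" "f pt_b = s2" "f pt_c = s1" "f pt_d = w" "f pt_e = t1" "f pt_f = t2" "f pt_g = p"
    "f pt_h = u1" "f pt_i = u2"
    by (simp_all add: f_def)
  let ?P = "{pt_a, pt_b, pt_c, pt_d, pt_e, pt_f, pt_g, pt_h, pt_i}"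
  let ?C = "{c2, c1, f', b2, d1, d2, b, e1, e2}"
  have fP: "f ` ?P = {q, s2, s1, w, t1, t2, p, u1, u2}" by (simp add: f)
  have "p \<in> N b" "q \<in> N b" "p \<in> N b2" "s1 \<in> N b2" "s2 \<in> N b2" "t1 \<in> N c1" "q \<in> N c1" "t2 \<in> N c2" "q \<in> N c2"
      "s1 \<in> N d1" "u1 \<in> N d1" "w \<in> N d1" "s2 \<in> N d2" "u2 \<in> N d2" "t1 \<in> N e1" "t2 \<in> N e2" "w \<in> N f'"
    using N by auto
  then have side: "side p \<noteq> side b" "side q \<noteq> side b" "side p \<noteq> side b2" "side s1 \<noteq> side b2" "side s2 \<noteq> side b2"
      "side t1 \<noteq> side c1" "side q \<noteq> side c1" "side t2 \<noteq> side c2" "side q \<noteq> side c2"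
      "side s1 \<noteq> side d1" "side u1 \<noteq> side d1" "side w \<noteq> side d1" "side s2 \<noteq> side d2" "side u2 \<noteq> side d2"
      "side t1 \<noteq> side e1" "side t2 \<noteq> side e2" "side w \<noteq> side f'"
    using N_side by blast+
  show ?thesis unfolding Gamma_d_def
  proof (rule iso_incidence_graph[where f = f and C = ?C])
    show "inj_on f ?P" using dist by (simp add: f) auto
    show "V = f ` ?P \<union> ?C"
      unfolding fP by (rule vertices_eq[of p], simp, rule N_V(1)[OF \<open>p \<in> N b\<close>]) (auto simp: N)
    have "\<forall>x\<in>f ` ?P. side x = side p" "\<forall>c\<in>?C. side c \<noteq> side p" unfolding fP using side by auto
    then show "f ` ?P \<inter> ?C = {}" by fastforce
    have "N c2 = f ` {pt_a, pt_b, pt_f}" "N c1 = f ` {pt_a, pt_c, pt_e}" "N f' = f ` {pt_d, pt_e, pt_f}" "N b2 = f ` {pt_b, pt_c, pt_g}" "N d1 = f ` {pt_c, pt_d, pt_h}" "N d2 = f ` {pt_b, pt_d, pt_i}" "N b = f ` {pt_a, pt_g}" "N e1 = f ` {pt_e, pt_h}" "N e2 = f ` {pt_f, pt_i}" by (simp_all add: N f insert_commute)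
    then show "N ` ?C = (`) f ` {{pt_a, pt_b, pt_f}, {pt_a, pt_c, pt_e}, {pt_d, pt_e, pt_f}, {pt_b, pt_c, pt_g}, {pt_c, pt_d, pt_h}, {pt_b, pt_d, pt_i}, {pt_a, pt_g}, {pt_e, pt_h}, {pt_f, pt_i}}"
      by (simp only: image_insert image_empty)
    show "N (f x) \<subseteq> ?C" if "x \<in> ?P" for x using that by (elim insertE emptyE) (simp_all add: f N)
  qed simp
qed

theorem classification:
  assumes "card (N v) = 2"
  shows "digraph_iso (with_proj graph_of) (with_proj Gamma_a) \<or>
         digraph_iso (with_proj graph_of) (with_proj Gamma_b) \<or>
         digraph_iso (with_proj graph_of) (with_proj Gamma_c) \<or>
         digraph_iso (with_proj graph_of) (with_proj Gamma_d)"
proof (cases "\<exists>p. card (N p) = 2 \<and> (\<forall>b\<in>N p. card (N b) = 2)")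
  case True
  then obtain p where p: "card (N p) = 2" "\<And>b. b \<in> N p \<Longrightarrow> card (N b) = 2" by blast
  obtain q s b b2 c where C: "N p = {b2, b}" "N q = {b, c}" "N s = {c, b2}" "N b = {p, q}" "N c = {q, s}" "N b2 = {s, p}"
    "distinct [p, q, s]" "distinct [b, c, b2]"
    using hexagon[OF p] by metis
  show ?thesis using iso_Gamma_a[OF C] by blast
next
  case False
  then have nhex: "\<And>v. card (N v) = 2 \<Longrightarrow> \<exists>b\<in>N v. card (N b) \<noteq> 2" by metis
  obtain b b2 q s1 s2 c1 c2 where A:
    "N v = {b, b2}" "N b = {v, q}" "N b2 = {v, s1, s2}" "N q = {b, c1, c2}"
    "s1 \<in> N c1" "s2 \<in> N c2" "distinct [v, q, s1, s2]" "distinct [b, b2, c1, c2]"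
    using two_hexagons[OF assms nhex] .
  \<comment> \<open>The same theta graph with the paths through \<open>s1\<close> and
    \<open>s2\<close> exchanged, for the case \<open>left\<close>.\<close>
  have B: "N b2 = {v, s2, s1}" "N q = {b, c2, c1}" "distinct [v, q, s2, s1]" "distinct [b, b2, c2, c1]"
    using A(3,4,7,8) by auto
  have mem: "s1 \<in> N b2" "s2 \<in> N b2" "q \<in> N c1" "q \<in> N c2" "q \<noteq> s1" "q \<noteq> s2" "b2 \<noteq> c1" "b2 \<noteq> c2"
    using A(3,7,8) N_symD[OF A(4)] by auto
  have 3: "card (N b2) = 3" "card (N q) = 3" using A by simp_all
  consider (none) "card (N s1) = 2" "card (N s2) = 2" | (right) "card (N s1) = 2" "card (N s2) = 3"
    | (left) "card (N s1) = 3" "card (N s2) = 2" | (both) "card (N s1) = 3" "card (N s2) = 3"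
    using long_or_short[OF N_sym[OF mem(1)]] long_or_short[OF N_sym[OF mem(2)]] by blast
  then show ?thesis
  proof cases
    case none
    then show ?thesis
      using iso_Gamma_b[OF A(1-4) short_tail(1)[OF none(1) 3 mem(1) A(5) mem(3,5,7)]
          short_tail(1)[OF none(2) 3 mem(2) A(6) mem(4,6,8)]
          short_tail(2)[OF none(1) 3 mem(1) A(5) mem(3,5,7)]
          short_tail(2)[OF none(2) 3 mem(2) A(6) mem(4,6,8)] A(7,8)] by blast
  next
    case right
    obtain t u1 u2 d e1 e2 where C: "N s1 = {b2, c1}" "N c1 = {q, s1}" "N s2 = {b2, c2, d}" "N c2 = {q, s2, t}"
      "N t = {c2, e1, e2}" "N d = {s2, u1, u2}" "N e1 = {t, u1}" "N e2 = {t, u2}"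
      "N u1 = {d, e1}" "N u2 = {d, e2}" "distinct [v, q, s1, s2, t, u1, u2]"
      using one_tail[OF A right] .
    show ?thesis using iso_Gamma_c[OF A(1-4) C] by blast
  next
    case left
    obtain t u1 u2 d e1 e2 where C: "N s2 = {b2, c2}" "N c2 = {q, s2}" "N s1 = {b2, c1, d}" "N c1 = {q, s1, t}"
      "N t = {c1, e1, e2}" "N d = {s1, u1, u2}" "N e1 = {t, u1}" "N e2 = {t, u2}"
      "N u1 = {d, e1}" "N u2 = {d, e2}" "distinct [v, q, s2, s1, t, u1, u2]"
      using one_tail[OF A(1,2) B(1,2) A(6,5) B(3,4) left(2,1)] .
    show ?thesis using iso_Gamma_c[OF A(1,2) B(1,2) C] by blast
  next
    case both
    obtain t1 t2 u1 u2 w d1 d2 e1 e2 f where C: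
      "N c1 = {q, s1, t1}" "N c2 = {q, s2, t2}" "N f = {t1, t2, w}" "N d1 = {s1, u1, w}" "N d2 = {s2, u2, w}"
      "N e1 = {t1, u1}" "N e2 = {t2, u2}"
      "N s1 = {b2, c1, d1}" "N s2 = {b2, c2, d2}" "N t1 = {c1, f, e1}" "N t2 = {c2, f, e2}"
      "N u1 = {d1, e1}" "N u2 = {d2, e2}" "N w = {d1, d2, f}"
      "distinct [v, q, s1, s2, t1, t2, u1, u2, w]"
      using two_tails[OF A both nhex] .
    show ?thesis using iso_Gamma_d[OF A(1-4) C] by blast
  qed
qed

end

section \<open>From the library's graphs to neighbourhoods\<close>

lemma (in pair_graph) parcs_sym: "(y, x) \<in> parcs G \<Longrightarrow> (x, y) \<in> parcs G"
  using sym_arcs by (auto simp: symmetric_def dest: symD)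

text \<open>Two common neighbours would close a 4-cycle. In a bipartite graph, girth at least 6
  amounts to the absence of 4-cycles.\<close>

lemma (in pair_graph) common_neighbours_unique:
  assumes girth: "girth (with_proj G) \<ge> 6"
    and arcs: "(u, c) \<in> parcs G" "(v, c) \<in> parcs G" "(u, d) \<in> parcs G" "(v, d) \<in> parcs G" and "u \<noteq> v"
  shows "c = d"
proof (rule ccontr)
  assume "c \<noteq> d"
  let ?p = "[(u, c), (c, v), (v, d), (d, u)]"
  have "u \<noteq> c" "u \<noteq> d" "v \<noteq> c" "v \<noteq> d" using arcs[THEN pair_no_loops] by simp_all
  then have "cycle ?p"
    using arcs parcs_sym \<open>c \<noteq> d\<close> \<open>u \<noteq> v\<close> unfolding cycle_def
    by (intro exI[of _ u]) (auto simp: awalk_def in_arcsD1)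
  then have "girth (with_proj G) \<le> enat (length ?p)"
    unfolding girth_def by (intro INF_lower) auto
  then have "6 \<le> enat (length ?p)" using girth by (rule order_trans[rotated])
  then show False by (simp add: numeral_eq_enat)
qed

lemma (in pair_graph) out_degree_card: "out_degree (with_proj G) v = card {u. (v, u) \<in> parcs G}"
proof -
  have "out_arcs (with_proj G) v = Pair v ` {u. (v, u) \<in> parcs G}" by (auto simp: out_arcs_def)
  then show ?thesis by (simp add: out_degree_def card_image inj_on_def)
qed

lemma (in pair_graph) connected_closed:
  assumes "Digraph_Component.connected (with_proj G)"
    and S: "S \<subseteq> pverts G" "S \<noteq> {}" "\<And>v. v \<in> S \<Longrightarrow> {u. (v, u) \<in> parcs G} \<subseteq> S"
  shows "S = pverts G"
proof -
  obtain s where s: "s \<in> S" using S by blast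
  \<comment> \<open>Connectedness is defined as strong connectedness of the symmetrised graph, which
    has the same arcs here.\<close>
  have "parcs (mk_symmetric (with_proj G)) = parcs G"
    by (auto simp: mk_symmetric_def intro: parcs_sym)
  then have reach: "(s, v) \<in> rtrancl_on (pverts G) (parcs G)" if "v \<in> pverts G" for v
    using assms(1) s S(1) that
    by (auto simp: Digraph_Component.connected_def strongly_connected_def reachable_def mk_symmetric_def)
  have "v \<in> S" if "v \<in> pverts G" for v
    using reach[OF that] by (induction rule: rtrancl_on_induct) (use s S(3) in auto)
  then show ?thesis using S(1) by blast
qed

theorem theorem2p14:
  fixes H :: "'a pair_pre_digraph"
  assumes "pair_graph H"
    and "Digraph_Component.connected (with_proj H)"
    and "bipartite (with_proj H)"
    and "max_degree (with_proj H) \<le> 3"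
    and "min_degree (with_proj H) = 2"
    and "girth (with_proj H) \<ge> 6"
    and "\<not> (\<exists>x. adj_eigenvalue (with_proj H) x \<and> -1 < x \<and> x < 1)"
  shows "digraph_iso (with_proj H) (with_proj Gamma_a) \<or>
         digraph_iso (with_proj H) (with_proj Gamma_b) \<or>
         digraph_iso (with_proj H) (with_proj Gamma_c) \<or>
         digraph_iso (with_proj H) (with_proj Gamma_d)"
proof -
  interpret pair_graph H by fact
  define N where "N v = {u. (v, u) \<in> parcs H}" for v
  obtain U W where UW: "pverts H = U \<union> W" "U \<inter> W = {}" "parcs H \<subseteq> U \<times> W \<union> W \<times> U"
    using assms(3) by (auto simp: bipartite_def)
  have ne: "pverts H \<noteq> {}"
    using assms(2) by (simp add: Digraph_Component.connected_def strongly_connected_def mk_symmetric_def)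
  have deg: "out_degree (with_proj H) v = card (N v)" for v
    unfolding out_degree_card N_def ..
  have fin: "finite ((\<lambda>v. card (N v)) ` pverts H)" using pair_finite_verts by simp
  have min: "2 = Min ((\<lambda>v. card (N v)) ` pverts H)" and max: "Max ((\<lambda>v. card (N v)) ` pverts H) \<le> 3"
    using assms(4,5) by (simp_all add: min_degree_def max_degree_def deg)
  have degree: "card (N v) = 2 \<or> card (N v) = 3" if "v \<in> pverts H" for v
  proof -
    have "2 \<le> card (N v)" unfolding min using fin that by (intro Min_le) auto
    moreover have "card (N v) \<le> 3" using max fin that by (meson Max_ge imageI order_trans)
    ultimately show ?thesis by linarith
  qed
  have "2 \<in> (\<lambda>v. card (N v)) ` pverts H" unfolding min using fin ne by (intro Min_in) auto
  then obtain v where v: "card (N v) = 2" by auto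
  interpret neighbourhoods "pverts H" N
    by unfold_locales (auto simp: N_def in_arcsD2 pair_finite_verts parcs_sym)
  have G: "verts (with_proj H) = pverts H" "arcs_ends (with_proj H) = {(u, v). v \<in> N u}"
    by (auto simp: N_def)
  interpret expanding_subcubic "pverts H" N "\<lambda>v. v \<in> U"
  proof
    show "(u \<in> U) \<noteq> (v \<in> U)" if "u \<in> N v" for u v using that UW by (auto simp: N_def)
    show "c = d" if "c \<in> N u" "c \<in> N v" "d \<in> N u" "d \<in> N v" "u \<noteq> v" for c u v d
      using common_neighbours_unique[OF assms(6)] that by (simp add: N_def)
    show "form 1 x x \<ge> 0" for x using form_nonneg[OF G assms(7)] .
    show "S = pverts H" if "S \<subseteq> pverts H" "S \<noteq> {}" "\<And>v. v \<in> S \<Longrightarrow> N v \<subseteq> S" for S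
      using connected_closed[OF assms(2) that(1,2)] that(3) by (simp add: N_def)
  qed (rule degree)
  have "graph_of = H" by (simp add: graph_of_def N_def)
  then show ?thesis using classification[OF v] by simp
qed

end
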